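(* Let $(u,p,\theta)\in C^1(\mathbb R^2\times(0,T))$ be a solution of the 2D Boussinesq equations $$u_t+u\cdot\nabla u=-\nabla p+\theta e_2,\qquad \theta_t+u\cdot\nabla\theta=0,\qquad\nabla\cdot u=0$$ on $\mathbb R^2\times(0,T)$, and let $U,P,\xi,\zeta,\alpha,\rho$ and the material derivative $D_t$ be as defined in the context. Then the following identities hold on $\mathbb R^2\times(0,T)$ (at all points where the direction vectors occurring in them are defined, i.e. where $\nabla^\perp\theta\neq0$ for those involving $\xi$, and where $U\nabla^\perp\theta\ne0$ for those involving $\zeta$): $$D_t|U\nabla^\perp\theta|=-\zeta\cdot P\nabla^\perp\theta,$$ $$D_t^2\log|\nabla^\perp\theta|=|U\xi|^2-2\alpha^2-\rho,$$ $$(D_t|\nabla^\perp\theta|)^2+(|D_t\xi||\nabla^\perp\theta|)^2=|U\nabla^\perp\theta|^2,$$ $$(D_t|U\nabla^\perp\theta|)^2+(|D_t\zeta||U\nabla^\perp\theta|)^2=|P\nabla^\perp\theta|^2,$$ $$(D_t|U\nabla^\perp\theta|)^2+(|D_t\zeta|\,D_t|\nabla^\perp\theta|)^2+(|D_t\zeta||D_t\xi||\nabla^\perp\theta|)^2=|P\nabla^\perp\theta|^2.$$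
   Context: Here $u=(u_1,u_2)$ is the velocity, $p$ the pressure, $\theta$ the temperature, and $e_2=(0,1)$. Notation: $\nabla^\perp\theta=(-\partial_2\theta,\partial_1\theta)$; $U$ is the $2\times2$ velocity gradient matrix acting on vectors by $Uv=v\cdot\nabla u$, i.e. $(Uv)_i=\sum_jv_j\partial_ju_i$; $P=(\partial_i\partial_jp)$ is the Hessian of the pressure in the space variables (understood to exist as a continuous matrix-valued function). The direction vectors are $\xi=\nabla^\perp\theta/|\nabla^\perp\theta|$ and $\zeta=U\nabla^\perp\theta/|U\nabla^\perp\theta|$, and $\alpha=\xi\cdot U\xi$, $\rho=\xi\cdot P\xi$. The material derivative is $D_tf=\partial_tf+u\cdot\nabla f$; it is the derivative along particle trajectories, $(D_tf)(X(a,t),t)=\frac{\partial}{\partial t}\{f(X(a,t),t)\}$, where $\frac{\partial X(a,t)}{\partial t}=u(X(a,t),t)$, and this is how $D_t$ is understood for functions such as $\nabla^\perp\theta$, $U\nabla^\perp\theta$, $\xi$, $\zeta$ that need not be classically differentiable in $x$ and $t$ separately. *)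

theory Defs
  imports "HOL-Analysis.Analysis"
begin

text \<open>Space-time functions take a pair \<open>(x, t)\<close> with \<open>x :: real ^ 2\<close> and \<open>t :: real\<close>.\<close>

definition slab :: "real \<Rightarrow> ((real ^ 2) \<times> real) set" where
  "slab T = UNIV \<times> {0<..<T}"

definition C1_on :: "('a::real_normed_vector \<Rightarrow> 'b::real_normed_vector) \<Rightarrow> 'a set \<Rightarrow> bool" where
  "C1_on f S \<longleftrightarrow>
     (\<exists>f'. (\<forall>z\<in>S. (f has_derivative blinfun_apply (f' z)) (at z)) \<and> continuous_on S f')"

text \<open>\<open>dx j f\<close> (the spatial partial \<open>\<partial>\<^sub>j f\<close>) and \<open>dt f\<close> are unspecified where the partial derivative does not
  exist; \<open>C1_on\<close> (meant for open sets) and \<open>dx_exists\<close> guarantee existence where it matters.\<close>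

definition dx :: "2 \<Rightarrow> ((real ^ 2) \<times> real \<Rightarrow> 'b::real_normed_vector) \<Rightarrow> (real ^ 2) \<times> real \<Rightarrow> 'b" where
  "dx j f = (\<lambda>(x, t). vector_derivative (\<lambda>h. f (x + h *\<^sub>R axis j 1, t)) (at 0))"

definition dx_exists :: "2 \<Rightarrow> ((real ^ 2) \<times> real \<Rightarrow> 'b::real_normed_vector) \<Rightarrow> (real ^ 2) \<times> real \<Rightarrow> bool" where
  "dx_exists j f = (\<lambda>(x, t). (\<lambda>h. f (x + h *\<^sub>R axis j 1, t)) differentiable (at 0))"

definition dt :: "((real ^ 2) \<times> real \<Rightarrow> 'b::real_normed_vector) \<Rightarrow> (real ^ 2) \<times> real \<Rightarrow> 'b" where
  "dt f = (\<lambda>(x, t). vector_derivative (\<lambda>s. f (x, s)) (at t))"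

definition grad :: "((real ^ 2) \<times> real \<Rightarrow> real) \<Rightarrow> (real ^ 2) \<times> real \<Rightarrow> real ^ 2" where
  "grad f z = (\<chi> j. dx j f z)"

definition perp_grad :: "((real ^ 2) \<times> real \<Rightarrow> real) \<Rightarrow> (real ^ 2) \<times> real \<Rightarrow> real ^ 2" where
  "perp_grad f z = vector [- dx 2 f z, dx 1 f z]"

definition divergence :: "((real ^ 2) \<times> real \<Rightarrow> real ^ 2) \<Rightarrow> (real ^ 2) \<times> real \<Rightarrow> real" where
  "divergence u z = (\<Sum>j\<in>UNIV. dx j (\<lambda>w. u w $ j) z)"

definition convective ::
  "((real ^ 2) \<times> real \<Rightarrow> real ^ 2) \<Rightarrow> ((real ^ 2) \<times> real \<Rightarrow> 'b::real_normed_vector) \<Rightarrow> (real ^ 2) \<times> real \<Rightarrow> 'b" where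
  "convective u f z = (\<Sum>j\<in>UNIV. (u z $ j) *\<^sub>R dx j f z)"

definition vel_grad :: "((real ^ 2) \<times> real \<Rightarrow> real ^ 2) \<Rightarrow> (real ^ 2) \<times> real \<Rightarrow> real ^ 2 ^ 2" where
  "vel_grad u z = (\<chi> i j. dx j (\<lambda>w. u w $ i) z)"

definition hessian :: "((real ^ 2) \<times> real \<Rightarrow> real) \<Rightarrow> (real ^ 2) \<times> real \<Rightarrow> real ^ 2 ^ 2" where
  "hessian p z = (\<chi> i j. dx i (dx j p) z)"

definition continuous_hessian_on :: "((real ^ 2) \<times> real \<Rightarrow> real) \<Rightarrow> ((real ^ 2) \<times> real) set \<Rightarrow> bool" where
  "continuous_hessian_on p S \<longleftrightarrow>
     (\<forall>z\<in>S. \<forall>i j. dx_exists i (dx j p) z) \<and> continuous_on S (hessian p)"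

definition boussinesq_2d ::
  "((real ^ 2) \<times> real \<Rightarrow> real ^ 2) \<Rightarrow> ((real ^ 2) \<times> real \<Rightarrow> real) \<Rightarrow> ((real ^ 2) \<times> real \<Rightarrow> real) \<Rightarrow> real \<Rightarrow> bool" where
  "boussinesq_2d u p \<theta> T \<longleftrightarrow>
     (\<forall>z\<in>slab T.
        dt u z + convective u u z = - grad p z + \<theta> z *\<^sub>R axis 2 1 \<and>
        dt \<theta> z + convective u \<theta> z = 0 \<and>
        divergence u z = 0)"

text \<open>Particle trajectories need only exist locally in time, since \<open>u\<close> may be unbounded;
  the material derivative at \<open>z = (x, t)\<close> only sees the trajectory near time \<open>t\<close>.\<close>

definition trajectory_through ::
  "((real ^ 2) \<times> real \<Rightarrow> real ^ 2) \<Rightarrow> (real ^ 2) \<times> real \<Rightarrow> (real \<Rightarrow> real ^ 2) \<Rightarrow> bool" where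
  "trajectory_through u z X \<longleftrightarrow>
     X (snd z) = fst z \<and>
     (\<forall>\<^sub>F s in nhds (snd z). (X has_vector_derivative u (X s, s)) (at s))"

text \<open>Existence of a trajectory is part of the definition, so that it never holds vacuously
  and the value \<open>d\<close> is unique.\<close>

definition has_material_derivative ::
  "((real ^ 2) \<times> real \<Rightarrow> real ^ 2) \<Rightarrow> ((real ^ 2) \<times> real \<Rightarrow> 'b::real_normed_vector) \<Rightarrow> 'b \<Rightarrow> (real ^ 2) \<times> real \<Rightarrow> bool" where
  "has_material_derivative u f d z \<longleftrightarrow>
     (\<exists>X. trajectory_through u z X) \<and>
     (\<forall>X. trajectory_through u z X \<longrightarrow>
        ((\<lambda>s. f (X s, s)) has_vector_derivative d) (at (snd z)))"

definition material_differentiable ::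
  "((real ^ 2) \<times> real \<Rightarrow> real ^ 2) \<Rightarrow> ((real ^ 2) \<times> real \<Rightarrow> 'b::real_normed_vector) \<Rightarrow> (real ^ 2) \<times> real \<Rightarrow> bool" where
  "material_differentiable u f z \<longleftrightarrow> (\<exists>d. has_material_derivative u f d z)"

definition Dt ::
  "((real ^ 2) \<times> real \<Rightarrow> real ^ 2) \<Rightarrow> ((real ^ 2) \<times> real \<Rightarrow> 'b::real_normed_vector) \<Rightarrow> (real ^ 2) \<times> real \<Rightarrow> 'b" where
  "Dt u f z = (THE d. has_material_derivative u f d z)"

lemma has_material_derivative_unique:
  assumes "has_material_derivative u f d z" "has_material_derivative u f d' z"
  shows "d = d'"
  using assms unfolding has_material_derivative_def
  by (meson vector_derivative_unique_at)

lemma Dt_eqI: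
  assumes "has_material_derivative u f d z"
  shows "Dt u f z = d"
  unfolding Dt_def using assms has_material_derivative_unique by blast

text \<open>For a function that is differentiable in space-time, the derivative along trajectories is the
  classical \<open>\<partial>\<^sub>t f + u \<cdot> \<nabla>f\<close>.\<close>

lemma Dt_classical:
  fixes f :: "(real ^ 2) \<times> real \<Rightarrow> 'b::real_normed_vector"
  assumes f: "f differentiable (at z)" and X: "trajectory_through u z X"
  shows "Dt u f z = dt f z + convective u f z"
proof -
  obtain x t where z: "z = (x, t)" by (cases z)
  obtain F where F: "(f has_derivative F) (at (x, t))"
    using f unfolding z differentiable_def by blast
  interpret F: bounded_linear F using F by (rule has_derivative_bounded_linear)
  have dxf: "dx j f z = F (axis j 1, 0)" for j
  proof -
    have "((\<lambda>h. (x + h *\<^sub>R axis j 1, t)) has_derivative (\<lambda>h. (h *\<^sub>R axis j 1, 0))) (at 0)"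
      by (auto intro!: derivative_eq_intros)
    from has_derivative_compose[OF this, of f F]
    have "((\<lambda>h. f (x + h *\<^sub>R axis j 1, t)) has_derivative (\<lambda>h. F (h *\<^sub>R axis j 1, 0))) (at 0)"
      using F by simp
    moreover have "(\<lambda>h. F (h *\<^sub>R axis j 1, 0)) = (\<lambda>h. h *\<^sub>R F (axis j 1, 0))"
      by (rule ext) (simp flip: F.scaleR)
    ultimately show ?thesis
      unfolding dx_def z by (simp add: has_vector_derivative_def vector_derivative_at)
  qed
  have dtf: "dt f z = F (0, 1)"
  proof -
    have "((\<lambda>s. f (x, s)) has_derivative (\<lambda>h. F (0, h))) (at t)"
      using has_derivative_compose[OF has_derivative_Pair[OF has_derivative_const has_derivative_ident] F]
      by simp
    moreover have "(\<lambda>h. F (0, h)) = (\<lambda>h. h *\<^sub>R F (0, 1))"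
      by (rule ext) (simp flip: F.scaleR)
    ultimately show ?thesis
      unfolding dt_def z by (simp add: has_vector_derivative_def vector_derivative_at)
  qed
  have sum: "F (u z, 1) = dt f z + convective u f z"
  proof -
    have "u z = (\<Sum>j\<in>UNIV. (u z $ j) *\<^sub>R axis j 1)"
      by (simp add: vec_eq_iff axis_def if_distrib cong: if_cong)
    then have "(u z, 1) = (0, 1) + (\<Sum>j\<in>UNIV. (u z $ j) *\<^sub>R (axis j 1, 0::real))"
      by (simp add: sum_2 prod_eq_iff)
    then show ?thesis
      unfolding convective_def dxf dtf by (simp only: F.add F.sum F.scaleR)
  qed
  have "((\<lambda>s. f (Y s, s)) has_vector_derivative F (u z, 1)) (at t)"
    if Y: "trajectory_through u z Y" for Y
  proof -
    have Yt: "Y t = x" and Y': "(Y has_vector_derivative u (x, t)) (at t)"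
      using Y unfolding trajectory_through_def z by (auto dest: eventually_nhds_x_imp_x)
    have "((\<lambda>s. (Y s, s)) has_vector_derivative (u z, 1)) (at t)"
      using Y' unfolding z by (intro has_vector_derivative_Pair) auto
    then have "((f \<circ> (\<lambda>s. (Y s, s))) has_vector_derivative F (u z, 1)) (at t)"
      by (rule vector_derivative_diff_chain_within)
         (use F Yt in \<open>auto intro: has_derivative_at_withinI\<close>)
    then show ?thesis by (simp add: o_def)
  qed
  then have "has_material_derivative u f (F (u z, 1)) z"
    using X unfolding has_material_derivative_def by (auto simp: z)
  then show ?thesis by (simp add: Dt_eqI sum)
qed

definition U_perp_grad ::
  "((real ^ 2) \<times> real \<Rightarrow> real ^ 2) \<Rightarrow> ((real ^ 2) \<times> real \<Rightarrow> real) \<Rightarrow> (real ^ 2) \<times> real \<Rightarrow> real ^ 2" where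
  "U_perp_grad u \<theta> z = vel_grad u z *v perp_grad \<theta> z"

definition xi :: "((real ^ 2) \<times> real \<Rightarrow> real) \<Rightarrow> (real ^ 2) \<times> real \<Rightarrow> real ^ 2" where
  "xi \<theta> z = perp_grad \<theta> z /\<^sub>R norm (perp_grad \<theta> z)"

definition zeta ::
  "((real ^ 2) \<times> real \<Rightarrow> real ^ 2) \<Rightarrow> ((real ^ 2) \<times> real \<Rightarrow> real) \<Rightarrow> (real ^ 2) \<times> real \<Rightarrow> real ^ 2" where
  "zeta u \<theta> z = U_perp_grad u \<theta> z /\<^sub>R norm (U_perp_grad u \<theta> z)"

definition alpha ::
  "((real ^ 2) \<times> real \<Rightarrow> real ^ 2) \<Rightarrow> ((real ^ 2) \<times> real \<Rightarrow> real) \<Rightarrow> (real ^ 2) \<times> real \<Rightarrow> real" where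
  "alpha u \<theta> z = xi \<theta> z \<bullet> (vel_grad u z *v xi \<theta> z)"

definition rho ::
  "((real ^ 2) \<times> real \<Rightarrow> real) \<Rightarrow> ((real ^ 2) \<times> real \<Rightarrow> real) \<Rightarrow> (real ^ 2) \<times> real \<Rightarrow> real" where
  "rho p \<theta> z = xi \<theta> z \<bullet> (hessian p z *v xi \<theta> z)"

end

theory Submission
  imports Defs
begin

text \<open>
  Everything follows from \<open>D\<^sub>t \<nabla>\<^sup>\<bottom>\<theta> = U \<nabla>\<^sup>\<bottom>\<theta>\<close> and \<open>D\<^sub>t (U \<nabla>\<^sup>\<bottom>\<theta>) = - P \<nabla>\<^sup>\<bottom>\<theta>\<close> by elementary calculus along a
  trajectory. Neither can be obtained by differentiating the equations in space, as the solution is only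
  \<open>C\<^sup>1\<close>. Instead, neighbouring trajectories are compared: the difference quotients of the flow in direction \<open>v\<close>
  converge uniformly to the solution \<open>W\<close> of \<open>W' = U W\<close>, \<open>W(t) = v\<close>. Since \<open>\<theta>\<close> is constant on trajectories,
  \<open>\<nabla>\<theta> \<bullet> W\<close> is conserved, and since \<open>U\<close> is trace free, so is the determinant of two such \<open>W\<close>; together this makes
  \<open>\<nabla>\<^sup>\<bottom>\<theta>\<close> itself a solution of \<open>W' = U W\<close>. The velocity has derivative \<open>- \<nabla>p + \<theta> e\<^sub>2\<close> along trajectories, so the
  difference quotients of the velocity have uniformly convergent time derivatives, which yields
  \<open>(U W)' = - P W + (\<nabla>\<theta> \<bullet> v) e\<^sub>2\<close>; the last term vanishes for \<open>v = \<nabla>\<^sup>\<bottom>\<theta>\<close>.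
\<close>

section \<open>Ordinary differential equations over a short time\<close>

text \<open>Mean value inequality for curves: the derivative
  \<open>\<lambda>h. h *\<^sub>R f' s\<close> has operator norm at most
  \<open>norm (f' s)\<close>.\<close>

lemma vector_differentiable_bound:
  fixes f :: "real \<Rightarrow> 'a::real_normed_vector"
  assumes "convex S" "\<And>x. x \<in> S \<Longrightarrow> (f has_vector_derivative f' x) (at x within S)"
    and "\<And>x. x \<in> S \<Longrightarrow> norm (f' x) \<le> B" and "x \<in> S" "y \<in> S"
  shows "norm (f x - f y) \<le> B * \<bar>x - y\<bar>"
proof -
  have "onorm (\<lambda>h. h *\<^sub>R f' s) \<le> B" if "s \<in> S" for s
    using assms(3)[OF that] by (intro onorm_le) (metis abs_ge_zero mult.commute mult_right_mono norm_scaleR real_norm_def)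
  then show ?thesis
    using differentiable_bound[of S f "\<lambda>s h. h *\<^sub>R f' s" B x y] assms
    by (simp add: has_vector_derivative_def)
qed

text \<open>A replacement for Gronwall's inequality: on an interval with
  \<open>L * d \<le> 1 / 2\<close>, the growth term at the point where \<open>norm (Y s)\<close> is
  largest can be absorbed into the left side. With \<open>e = 0\<close> it gives stability of
  trajectories; with small \<open>e\<close> it controls the error of difference quotients.\<close>

lemma short_time_bound:
  fixes Y :: "real \<Rightarrow> 'a::real_normed_vector"
  assumes "0 \<le> d" and Ld: "0 \<le> L" "L * d \<le> 1 / 2"
    and der: "\<And>s. s \<in> {t - d..t + d} \<Longrightarrow> (Y has_vector_derivative Y' s) (at s within {t - d..t + d})"
    and bd: "\<And>s. s \<in> {t - d..t + d} \<Longrightarrow> norm (Y' s) \<le> L * norm (Y s) + e"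
    and "0 \<le> e" and s: "s \<in> {t - d..t + d}"
  shows "norm (Y s) \<le> 2 * (norm (Y t) + e * d)"
proof -
  let ?I = "{t - d..t + d}"
  have "continuous_on ?I Y"
    using der by (rule continuous_on_vector_derivative)
  then have "continuous_on ?I (\<lambda>s. norm (Y s))"
    by (intro continuous_intros)
  moreover have "compact ?I" "?I \<noteq> {}"
    using assms(1) by auto
  ultimately obtain m where m: "m \<in> ?I" "\<And>s. s \<in> ?I \<Longrightarrow> norm (Y s) \<le> norm (Y m)"
    using continuous_attains_sup by metis
  \<comment> \<open>The maximality of \<open>m\<close> bounds the derivative on the whole interval
    by a constant, so the mean value inequality between \<open>t\<close> and \<open>m\<close>
    applies.\<close>
  have "norm (Y m - Y t) \<le> (L * norm (Y m) + e) * \<bar>m - t\<bar>"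
  proof (rule vector_differentiable_bound[OF _ der])
    show "norm (Y' s) \<le> L * norm (Y m) + e" if "s \<in> ?I" for s
      using bd[OF that] mult_left_mono[OF m(2)[OF that] Ld(1)] by linarith
  qed (use m assms(1) in auto)
  also have "\<dots> \<le> (L * norm (Y m) + e) * d"
    using m(1) assms(6) Ld(1) by (intro mult_left_mono) auto
  also have "\<dots> = (L * d) * norm (Y m) + e * d"
    by (simp add: algebra_simps)
  also have "\<dots> \<le> (1 / 2) * norm (Y m) + e * d"
    using Ld(2) by (intro add_right_mono mult_right_mono) auto
  finally have "norm (Y m) \<le> 2 * (norm (Y t) + e * d)"
    using norm_triangle_sub[of "Y m" "Y t"] by (simp add: algebra_simps)
  then show ?thesis
    using m(2)[OF s] by linarith
qed

text \<open>Picard's integral operator is a contraction with factor \<open>L * d\<close> on bounded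
  continuous functions, so Banach's fixed point theorem gives a solution on both sides of
  \<open>t\<close> at once.\<close>

lemma short_time_ode_solution:
  fixes f :: "'a::banach \<times> real \<Rightarrow> 'a" and x0 :: 'a and t d L :: real
  defines "I \<equiv> {t - d..t + d}"
  assumes "0 \<le> d" and Ld: "0 \<le> L" "L * d < 1"
    and cont: "continuous_on (UNIV \<times> I) f"
    and lip: "\<And>s x y. s \<in> I \<Longrightarrow> norm (f (x, s) - f (y, s)) \<le> L * norm (x - y)"
  obtains X where "X t = x0" "\<And>s. s \<in> I \<Longrightarrow> (X has_vector_derivative f (X s, s)) (at s within I)"
proof -
  \<comment> \<open>Clamping time to \<open>I\<close> extends each iterate to the whole line, so
    that the complete space of bounded continuous functions on \<open>real\<close> can be
    used.\<close>
  define c where "c s = max (t - d) (min (t + d) s)" for s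
  have cI: "c s \<in> I" for s
    using assms(2) unfolding c_def I_def by auto
  have cid: "c s = s" if "s \<in> I" for s
    using that unfolding c_def I_def by auto
  have tI: "t \<in> I"
    using assms(2) unfolding I_def by auto
  \<comment> \<open>The integral starts at the left end of \<open>I\<close>; subtracting
    \<open>J X t\<close> in \<open>G\<close> moves its base point to \<open>t\<close> with one
    formula for both sides.\<close>
  define J where "J X s = integral {t - d..s} (\<lambda>r. f (apply_bcontfun X r, r))" for X s
  define G where "G X s = x0 + (J X (c s) - J X t)" for X s
  have g: "continuous_on I (\<lambda>r. f (apply_bcontfun X r, r))" for X :: "real \<Rightarrow>\<^sub>C 'a"
    by (rule continuous_on_compose2[OF cont]) (auto intro!: continuous_intros)
  have J': "(J X has_vector_derivative f (apply_bcontfun X s, s)) (at s within I)" if "s \<in> I" for X s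
    using integral_has_vector_derivative[OF g[unfolded I_def] that[unfolded I_def]]
    unfolding J_def I_def .
  have Jc: "continuous_on I (J X)" for X
    using J' by (rule continuous_on_vector_derivative)
  have "G X \<in> bcontfun" for X
  proof -
    have cc: "continuous_on UNIV c"
      unfolding c_def by (intro continuous_intros)
    have 1: "continuous_on UNIV (G X)"
      unfolding G_def by (intro continuous_intros continuous_on_compose2[OF Jc cc]) (use cI in auto)
    have "compact ((\<lambda>s. x0 + (J X s - J X t)) ` I)"
      by (intro compact_continuous_image continuous_intros Jc) (auto simp: I_def)
    moreover have "range (G X) \<subseteq> (\<lambda>s. x0 + (J X s - J X t)) ` I"
      using cI unfolding G_def by auto
    ultimately have "bounded (range (G X))"
      by (meson bounded_subset compact_imp_bounded)
    with 1 show ?thesis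
      by (simp add: bcontfun_def)
  qed
  then have B: "apply_bcontfun (Bcontfun (G X)) = G X" for X
    by (simp add: Bcontfun_inverse)
  have "dist (Bcontfun (G X)) (Bcontfun (G Y)) \<le> (L * d) * dist X Y" for X Y
  proof (rule dist_bound)
    fix s
    \<comment> \<open>The derivative of \<open>J X - J Y\<close> is at most
      \<open>L * dist X Y\<close>, and \<open>c s\<close> lies within \<open>d\<close> of
      \<open>t\<close>; this gives the contraction factor.\<close>
    have "norm ((J X (c s) - J Y (c s)) - (J X t - J Y t)) \<le> (L * dist X Y) * \<bar>c s - t\<bar>"
    proof (rule vector_differentiable_bound)
      fix r assume r: "r \<in> I"
      show "((\<lambda>r. J X r - J Y r) has_vector_derivative f (apply_bcontfun X r, r) - f (apply_bcontfun Y r, r))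
          (at r within I)"
        by (intro derivative_intros J' r)
      have "norm (f (apply_bcontfun X r, r) - f (apply_bcontfun Y r, r))
          \<le> L * dist (apply_bcontfun X r) (apply_bcontfun Y r)"
        using lip[OF r] by (simp add: dist_norm)
      also have "\<dots> \<le> L * dist X Y"
        by (intro mult_left_mono dist_bounded Ld)
      finally show "norm (f (apply_bcontfun X r, r) - f (apply_bcontfun Y r, r)) \<le> L * dist X Y" .
    qed (use cI tI in \<open>auto simp: I_def\<close>)
    also have "\<dots> \<le> (L * dist X Y) * d"
      using cI[of s] Ld by (intro mult_left_mono) (auto simp: I_def)
    finally show "dist (apply_bcontfun (Bcontfun (G X)) s) (apply_bcontfun (Bcontfun (G Y)) s)
        \<le> L * d * dist X Y"
      unfolding B G_def dist_norm by (simp add: algebra_simps)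
  qed
  then obtain X where X: "Bcontfun (G X) = X"
    using banach_fix_type[of "L * d" "\<lambda>X. Bcontfun (G X)"] Ld assms(2) by auto
  have GX: "apply_bcontfun X s = x0 + (J X s - J X t)" if "s \<in> I" for s
    using B[of X] cid[OF that] unfolding X G_def by metis
  show ?thesis
  proof
    show "apply_bcontfun X t = x0"
      using GX[OF tI] by simp
    fix s assume s: "s \<in> I"
    have "((\<lambda>s. x0 + (J X s - J X t)) has_vector_derivative f (apply_bcontfun X s, s)) (at s within I)"
      using J'[OF s] by (auto intro!: derivative_eq_intros)
    then show "(apply_bcontfun X has_vector_derivative f (apply_bcontfun X s, s)) (at s within I)"
      by (rule has_vector_derivative_weaken) (use s GX in auto)
  qed
qed

section \<open>Differentiability of the flow in the initial value\<close>

text \<open>By compactness \<open>A\<close> is uniformly continuous, so its variation along a short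
  segment is below \<open>e\<close> with one \<open>\<eta>\<close> for all points and times.
  Convexity keeps the segment in \<open>S\<close>.\<close>

lemma uniform_linearization:
  fixes f :: "'a::euclidean_space \<times> real \<Rightarrow> 'b::real_normed_vector"
    and A :: "'a \<times> real \<Rightarrow> 'a \<Rightarrow>\<^sub>L 'b"
  assumes S: "compact S" "convex S" and "compact I"
    and der: "\<And>x s. x \<in> S \<Longrightarrow> s \<in> I \<Longrightarrow> ((\<lambda>y. f (y, s)) has_derivative A (x, s)) (at x)"
    and A: "continuous_on (S \<times> I) A" and "0 < e"
  obtains \<eta> where "0 < \<eta>"
    "\<And>x y s. x \<in> S \<Longrightarrow> y \<in> S \<Longrightarrow> s \<in> I \<Longrightarrow> norm (y - x) < \<eta> \<Longrightarrow>
       norm (f (y, s) - f (x, s) - A (x, s) (y - x)) \<le> e * norm (y - x)"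
proof -
  have "uniformly_continuous_on (S \<times> I) A"
    using S \<open>compact I\<close> by (intro compact_uniformly_continuous A compact_Times)
  then obtain \<eta> where \<eta>: "0 < \<eta>" "\<And>z w. z \<in> S \<times> I \<Longrightarrow> w \<in> S \<times> I \<Longrightarrow> dist w z < \<eta> \<Longrightarrow> dist (A w) (A z) < e"
    using \<open>0 < e\<close> unfolding uniformly_continuous_on_def by metis
  show ?thesis
  proof
    fix x y s assume h: "x \<in> S" "y \<in> S" "s \<in> I" "norm (y - x) < \<eta>"
    have seg: "x + r *\<^sub>R (y - x) \<in> S \<inter> ball x \<eta>" if "r \<in> {0..1}" for r
    proof -
      have "x + r *\<^sub>R (y - x) = (1 - r) *\<^sub>R x + r *\<^sub>R y"
        by (simp add: algebra_simps)
      then have "x + r *\<^sub>R (y - x) \<in> S"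
        using that h S(2)[unfolded convex_alt, rule_format, of x y r] by auto
      moreover have "\<bar>r\<bar> * norm (y - x) \<le> 1 * norm (y - x)"
        using that by (intro mult_right_mono) auto
      then have "dist x (x + r *\<^sub>R (y - x)) < \<eta>"
        using h(4) by (simp add: dist_norm del: abs_le_iff)
      ultimately show ?thesis
        by simp
    qed
    have "norm (f (y, s) - f (x, s) - A (x, s) (y - x)) \<le> norm (y - x) * e"
    proof (rule differentiable_bound_linearization[of x y "S \<inter> ball x \<eta>" "\<lambda>y. f (y, s)" "\<lambda>x. A (x, s)"])
      fix w assume w: "w \<in> S \<inter> ball x \<eta>"
      show "((\<lambda>y. f (y, s)) has_derivative A (w, s)) (at w within S \<inter> ball x \<eta>)"
        using der[of w s] w h by (auto intro: has_derivative_at_withinI)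
      have "dist (A (w, s)) (A (x, s)) < e"
        using w h \<eta> by (intro \<eta>(2)) (auto simp: dist_Pair_Pair dist_commute)
      then show "onorm (blinfun_apply (A (w, s)) - blinfun_apply (A (x, s))) \<le> e"
        by (simp add: dist_norm norm_blinfun.rep_eq fun_diff_def minus_blinfun.rep_eq)
    qed (use seg h \<eta> in auto)
    then show "norm (f (y, s) - f (x, s) - A (x, s) (y - x)) \<le> e * norm (y - x)"
      by (simp add: mult.commute)
  qed (fact \<eta>)
qed

lemma lipschitz_from_partial:
  fixes f :: "'a::euclidean_space \<times> real \<Rightarrow> 'b::real_normed_vector"
    and A :: "'a \<times> real \<Rightarrow> 'a \<Rightarrow>\<^sub>L 'b"
  assumes S: "convex S"
    and der: "\<And>x. x \<in> S \<Longrightarrow> ((\<lambda>y. f (y, s)) has_derivative A (x, s)) (at x)"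
    and L: "\<And>x. x \<in> S \<Longrightarrow> norm (A (x, s)) \<le> L" and "x \<in> S" "y \<in> S"
  shows "norm (f (x, s) - f (y, s)) \<le> L * norm (x - y)"
  using assms
  by (intro differentiable_bound[of S "\<lambda>y. f (y, s)" "\<lambda>x. A (x, s)"])
    (auto intro: has_derivative_at_withinI simp: norm_blinfun.rep_eq)

section \<open>Solutions confined to a set, and local existence for a common time\<close>

definition solves_on :: "('a::real_normed_vector \<times> real \<Rightarrow> 'a) \<Rightarrow> 'a set \<Rightarrow> real set \<Rightarrow> (real \<Rightarrow> 'a) \<Rightarrow> bool" where
  "solves_on u S I X \<longleftrightarrow> (\<forall>s\<in>I. X s \<in> S \<and> (X has_vector_derivative u (X s, s)) (at s within I))"

lemma solves_onD:
  assumes "solves_on u S I X" "s \<in> I"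
  shows "X s \<in> S" "(X has_vector_derivative u (X s, s)) (at s within I)"
  using assms unfolding solves_on_def by auto

lemma solves_on_continuous: "solves_on u S I X \<Longrightarrow> continuous_on I X"
  by (rule continuous_on_vector_derivative) (rule solves_onD)

text \<open>The derivative is total in space at frozen time, and continuous in space and time
  jointly. This form covers \<open>grad p\<close>, whose spatial derivative is controlled by the
  Hessian while nothing is known about its time derivative.\<close>

definition partial_derivative_on ::
  "('a::euclidean_space \<times> real \<Rightarrow> 'b::real_normed_vector) \<Rightarrow> ('a \<times> real \<Rightarrow> 'a \<Rightarrow>\<^sub>L 'b) \<Rightarrow> ('a \<times> real) set \<Rightarrow> bool" where
  "partial_derivative_on f A K \<longleftrightarrow>
     (\<forall>(x, s)\<in>K. ((\<lambda>y. f (y, s)) has_derivative A (x, s)) (at x)) \<and> continuous_on K A"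

lemma partial_derivative_onD:
  assumes "partial_derivative_on f A K"
  shows "(x, s) \<in> K \<Longrightarrow> ((\<lambda>y. f (y, s)) has_derivative A (x, s)) (at x)" "continuous_on K A"
  using assms unfolding partial_derivative_on_def by auto

lemma partial_derivative_on_subset:
  "partial_derivative_on f A K \<Longrightarrow> K' \<subseteq> K \<Longrightarrow> partial_derivative_on f A K'"
  unfolding partial_derivative_on_def by (auto intro: continuous_on_subset)

lemma bounded_on_compact:
  fixes f :: "'a::topological_space \<Rightarrow> 'b::real_normed_vector"
  assumes "compact K" "continuous_on K f"
  obtains M where "0 < M" "\<And>z. z \<in> K \<Longrightarrow> norm (f z) \<le> M"
  using compact_imp_bounded[OF compact_continuous_image[OF assms(2,1)]] unfolding bounded_pos by auto

text \<open>On a compact cylinder the field has speed at most \<open>M\<close> and Lipschitz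
  constant \<open>L\<close>. A solution starting in the half ball cannot leave the ball while
  \<open>M * d \<le> r / 2\<close>, so one \<open>d\<close> serves all these starting points. Every
  shorter \<open>d'\<close> is included because the interval may later shrink to fit a given
  trajectory.\<close>

lemma local_solutions:
  fixes u :: "'a::euclidean_space \<times> real \<Rightarrow> 'a"
  assumes "open \<Omega>" "(a, t) \<in> \<Omega>" and u: "continuous_on \<Omega> u" and A: "partial_derivative_on u A \<Omega>"
  obtains r d L where "0 < r" "0 < d" "0 \<le> L" "L * d \<le> 1 / 2"
    "cball a r \<times> {t - d..t + d} \<subseteq> \<Omega>"
    "\<forall>z\<in>cball a r \<times> {t - d..t + d}. norm (A z) \<le> L"
    "\<forall>d' b. 0 < d' \<and> d' \<le> d \<and> b \<in> cball a (r / 2) \<longrightarrow>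
        (\<exists>Y. Y t = b \<and> solves_on u (cball a r) {t - d'..t + d'} Y)"
proof -
  obtain U V where UV: "open U" "open V" "(a, t) \<in> U \<times> V" "U \<times> V \<subseteq> \<Omega>"
    using open_prod_elim[OF assms(1,2)] by metis
  obtain r where r: "0 < r" "cball a r \<subseteq> U"
    using UV by (auto simp: open_contains_cball)
  obtain d0 where d0: "0 < d0" "cball t d0 \<subseteq> V"
    using UV by (auto simp: open_contains_cball)
  let ?S = "cball a r"
  let ?K = "?S \<times> {t - d0..t + d0}"
  have K\<Omega>: "?K \<subseteq> \<Omega>"
    using UV(4) r d0 by (auto simp: cball_eq_atLeastAtMost subset_iff)
  have K: "compact ?K"
    by (intro compact_Times) auto
  obtain M where M: "0 < M" "\<And>z. z \<in> ?K \<Longrightarrow> norm (u z) \<le> M"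
    using bounded_on_compact[OF K continuous_on_subset[OF u K\<Omega>]] by metis
  obtain L where L: "0 < L" "\<And>z. z \<in> ?K \<Longrightarrow> norm (A z) \<le> L"
    using bounded_on_compact[OF K continuous_on_subset[OF partial_derivative_onD(2)[OF A] K\<Omega>]] by metis
  \<comment> \<open>The three bounds keep the cylinder inside \<open>\<Omega>\<close>, give
    \<open>L * d \<le> 1 / 2\<close>, and confine solutions from the half ball to the ball.\<close>
  define d where "d = min d0 (min (1 / (2 * L)) (r / (2 * M)))"
  have d: "0 < d" "d \<le> d0" "L * d \<le> 1 / 2" "M * d \<le> r / 2"
  proof -
    have "d \<le> 1 / (2 * L)" "d \<le> r / (2 * M)"
      unfolding d_def by auto
    then show "L * d \<le> 1 / 2" "M * d \<le> r / 2"
      using L(1) M(1) by (simp_all add: field_simps)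
  qed (use d0 L(1) M(1) r(1) in \<open>auto simp: d_def\<close>)
  have cp: "closest_point ?S x \<in> ?S" for x
    using r by (intro closest_point_in_set) auto
  have sol: "\<exists>Y. Y t = b \<and> solves_on u ?S {t - d'..t + d'} Y"
    if d': "0 < d'" "d' \<le> d" and b: "b \<in> cball a (r / 2)" for d' b
  proof -
    let ?I = "{t - d'..t + d'}"
    have sub: "?S \<times> ?I \<subseteq> ?K"
      using d' d by (intro Sigma_mono) auto
    txt \<open>Composing with the projection onto the ball makes the field globally Lipschitz.\<close>
    define f where "f = (\<lambda>(x, s). u (closest_point ?S x, s))"
    obtain Y where Y: "Y t = b" "\<And>s. s \<in> ?I \<Longrightarrow> (Y has_vector_derivative f (Y s, s)) (at s within ?I)"
    proof (rule short_time_ode_solution[of d' L t f b])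
      show "L * d' < 1"
        using d'(2) d(3) L(1) mult_left_mono[of d' d L] by linarith
      have cont: "continuous_on UNIV (closest_point ?S)"
        using r by (intro continuous_on_closest_point) auto
      show "continuous_on (UNIV \<times> ?I) f"
        unfolding f_def case_prod_beta
        by (rule continuous_on_compose2[OF continuous_on_subset[OF u K\<Omega>]])
          (use cp d' d in \<open>auto intro!: continuous_intros continuous_on_compose2[OF cont]\<close>)
      fix s x y assume s: "s \<in> ?I"
      have "norm (f (x, s) - f (y, s)) \<le> L * norm (closest_point ?S x - closest_point ?S y)"
        unfolding f_def prod.case
      proof (rule lipschitz_from_partial[of ?S u s A])
        fix x assume "x \<in> ?S"
        then have "(x, s) \<in> ?K"
          using s sub by blast
        then show "((\<lambda>y. u (y, s)) has_derivative A (x, s)) (at x)" "norm (A (x, s)) \<le> L"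
          using partial_derivative_onD(1)[OF A] K\<Omega> L(2) by blast+
      qed (use cp in auto)
      also have "\<dots> \<le> L * norm (x - y)"
        using closest_point_lipschitz[of ?S x y] L(1) r(1)
        by (intro mult_left_mono) (auto simp: dist_norm)
      finally show "norm (f (x, s) - f (y, s)) \<le> L * norm (x - y)" .
    qed (use d' L(1) in auto)
    \<comment> \<open>The projected field is bounded by \<open>M\<close> everywhere, so
      \<open>Y\<close> moves at most \<open>r / 2\<close> from \<open>b\<close>. Once
      \<open>Y\<close> is known to stay in the ball, the projection acts as the identity and
      \<open>Y\<close> solves the original equation.\<close>
    have "Y s \<in> ?S" if s: "s \<in> ?I" for s
    proof -
      have "norm (Y s - Y t) \<le> M * \<bar>s - t\<bar>"
      proof (rule vector_differentiable_bound[OF _ Y(2)])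
        fix q assume "q \<in> ?I"
        then have "(closest_point ?S (Y q), q) \<in> ?K"
          using cp sub by blast
        then show "norm (f (Y q, q)) \<le> M"
          unfolding f_def prod.case by (rule M(2))
      qed (use s d' in auto)
      also have "\<dots> \<le> M * d"
        using s d' M(1) by (intro mult_left_mono) auto
      also have "\<dots> \<le> r / 2"
        by (fact d)
      finally show ?thesis
        using b Y(1) dist_triangle[of a "Y s" b] by (auto simp: dist_norm norm_minus_commute)
    qed
    then have "solves_on u ?S ?I Y"
      using Y(2) unfolding solves_on_def f_def prod.case by (metis closest_point_self)
    with Y(1) show ?thesis
      by auto
  qed
  have sub: "?S \<times> {t - d..t + d} \<subseteq> ?K"
    using d by (intro Sigma_mono) auto
  have "\<forall>d' b. 0 < d' \<and> d' \<le> d \<and> b \<in> cball a (r / 2) \<longrightarrow>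
        (\<exists>Y. Y t = b \<and> solves_on u (cball a r) {t - d'..t + d'} Y)"
    using sol by blast
  moreover have "\<forall>z\<in>?S \<times> {t - d..t + d}. norm (A z) \<le> L"
    using sub L(2) by blast
  moreover have "?S \<times> {t - d..t + d} \<subseteq> \<Omega>"
    using sub K\<Omega> by (rule order_trans)
  ultimately show ?thesis
    using r(1) d(1,3) less_imp_le[OF L(1)] by (intro that)
qed

text \<open>\<open>Y n\<close> is the solution issuing from \<open>X t + h n *\<^sub>R v\<close>; the last clause says that the flow has the
  directional derivative \<open>W\<close> at \<open>X t\<close> in direction \<open>v\<close>, uniformly in time.\<close>

definition variation_of ::
  "('a::euclidean_space \<times> real \<Rightarrow> 'a) \<Rightarrow> ('a \<times> real \<Rightarrow> 'a \<Rightarrow>\<^sub>L 'a) \<Rightarrow> 'a set \<Rightarrow> real set \<Rightarrow> real \<Rightarrow> (real \<Rightarrow> 'a)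
    \<Rightarrow> 'a \<Rightarrow> (nat \<Rightarrow> real) \<Rightarrow> (nat \<Rightarrow> real \<Rightarrow> 'a) \<Rightarrow> (real \<Rightarrow> 'a) \<Rightarrow> bool" where
  "variation_of u A S I t X v h Y W \<longleftrightarrow>
     h \<longlonglongrightarrow> 0 \<and> (\<forall>n. h n \<noteq> 0) \<and>
     (\<forall>n. Y n t = X t + h n *\<^sub>R v \<and> solves_on u S I (Y n)) \<and>
     W t = v \<and> (\<forall>s\<in>I. (W has_vector_derivative A (X s, s) (W s)) (at s within I)) \<and>
     (\<forall>n. \<forall>s\<in>I. norm (Y n s - X s) \<le> 2 * norm v * \<bar>h n\<bar>) \<and>
     uniform_limit I (\<lambda>n s. (Y n s - X s) /\<^sub>R h n) W sequentially"

lemma norm_scaleR_inverse_le: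
  fixes x :: "'a::real_normed_vector"
  assumes "norm x \<le> c * \<bar>h\<bar>" "h \<noteq> 0"
  shows "norm (x /\<^sub>R h) \<le> c"
proof -
  have "norm (x /\<^sub>R h) = norm x / \<bar>h\<bar>"
    by (simp add: divide_inverse mult.commute)
  then show ?thesis
    using assms by (simp add: pos_divide_le_eq)
qed

text \<open>The error \<open>D\<close> between difference quotient and \<open>W\<close> starts at 0
  and solves the linear equation of \<open>W\<close> up to the linearization remainder divided by
  \<open>h n\<close>. That remainder is uniformly small, since the trajectories are within
  \<open>2 * norm v * \<bar>h n\<bar>\<close> of each other, and \<open>short_time_bound\<close>
  transfers the smallness to \<open>D\<close>.\<close>

lemma solutions_difference_quotient:
  fixes u :: "'a::euclidean_space \<times> real \<Rightarrow> 'a"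
  defines "I t d \<equiv> {t - d..t + d :: real}"
  assumes "0 < d" "0 \<le> L" "L * d \<le> 1 / 2" and S: "compact S" "convex S"
    and A: "partial_derivative_on u A (S \<times> I t d)"
    and L: "\<And>z. z \<in> S \<times> I t d \<Longrightarrow> norm (A z) \<le> L"
    and X: "solves_on u S (I t d) X"
    and h: "h \<longlonglongrightarrow> 0" "\<And>n. h n \<noteq> 0"
    and Y: "\<And>n. Y n t = X t + h n *\<^sub>R v" "\<And>n. solves_on u S (I t d) (Y n)"
    and W: "W t = v" "\<And>s. s \<in> I t d \<Longrightarrow> (W has_vector_derivative A (X s, s) (W s)) (at s within I t d)"
  shows "variation_of u A S (I t d) t X v h Y W"
proof -
  let ?I = "I t d"
  \<comment> \<open>Stability: the factor 2 is that of \<open>short_time_bound\<close>, applied to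
    the difference of two solutions with no inhomogeneity.\<close>
  have near: "norm (Y n s - X s) \<le> 2 * norm v * \<bar>h n\<bar>" if s: "s \<in> ?I" for n s
  proof -
    have "norm (Y n s - X s) \<le> 2 * (norm (Y n t - X t) + 0 * d)"
    proof (rule short_time_bound)
      fix q assume q: "q \<in> {t - d..t + d}"
      then show "((\<lambda>s. Y n s - X s) has_vector_derivative u (Y n q, q) - u (X q, q)) (at q within {t - d..t + d})"
        using solves_onD(2)[OF X] solves_onD(2)[OF Y(2)[of n]]
        by (intro derivative_intros) (auto simp: I_def)
      have "norm (u (Y n q, q) - u (X q, q)) \<le> L * norm (Y n q - X q)"
        by (rule lipschitz_from_partial[of S u q A])
          (use q S L X Y(2)[of n] partial_derivative_onD(1)[OF A] in \<open>auto simp: I_def solves_on_def\<close>)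
      then show "norm (u (Y n q, q) - u (X q, q)) \<le> L * norm (Y n q - X q) + 0"
        by simp
    qed (use assms s in \<open>auto simp: I_def\<close>)
    then show ?thesis
      by (simp add: Y(1) mult_ac)
  qed
  have "uniform_limit ?I (\<lambda>n s. (Y n s - X s) /\<^sub>R h n) W sequentially"
  proof (rule uniform_limitI)
    fix e :: real assume "0 < e"
    \<comment> \<open>Adding 1 keeps \<open>K\<close> positive when \<open>v = 0\<close>. With
      \<open>e'\<close> below, the final error bound \<open>4 * norm v * e' * d\<close> equals
      \<open>e * (norm v / (2 * K))\<close>, which is less than \<open>e\<close>.\<close>
    define K where "K = norm v + 1"
    have K: "0 < K" "norm v < K"
      by (auto simp: K_def add_nonneg_pos)
    define e' where "e' = e / (8 * K * d)"
    have e': "0 < e'"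
      unfolding e'_def using \<open>0 < e\<close> \<open>0 < d\<close> K by simp
    obtain \<eta> where \<eta>: "0 < \<eta>"
      "\<And>x y s. x \<in> S \<Longrightarrow> y \<in> S \<Longrightarrow> s \<in> ?I \<Longrightarrow> norm (y - x) < \<eta> \<Longrightarrow>
         norm (u (y, s) - u (x, s) - A (x, s) (y - x)) \<le> e' * norm (y - x)"
      by (rule uniform_linearization[of S ?I u A e'])
        (use S A e' in \<open>auto simp: I_def dest: partial_derivative_onD\<close>)
    have "((\<lambda>n. 2 * norm v * \<bar>h n\<bar>) \<longlongrightarrow> 2 * norm v * \<bar>0\<bar>) sequentially"
      by (intro tendsto_intros h)
    then have "\<forall>\<^sub>F n in sequentially. 2 * norm v * \<bar>h n\<bar> < \<eta>"
      using \<eta>(1) by (simp add: order_tendstoD)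
    then show "\<forall>\<^sub>F n in sequentially. \<forall>s\<in>?I. dist ((Y n s - X s) /\<^sub>R h n) (W s) < e"
    proof (eventually_elim, intro ballI)
      fix n s assume n: "2 * norm v * \<bar>h n\<bar> < \<eta>" and s: "s \<in> ?I"
      define D where "D s = (Y n s - X s) /\<^sub>R h n - W s" for s
      define D' where "D' s = (u (Y n s, s) - u (X s, s)) /\<^sub>R h n - A (X s, s) (W s)" for s
      have "norm (D s) \<le> 2 * (norm (D t) + 2 * norm v * e' * d)"
      proof (rule short_time_bound[of d L t D D'])
        fix q assume q: "q \<in> {t - d..t + d}"
        then have q': "q \<in> ?I"
          by (simp add: I_def)
        show "(D has_vector_derivative D' q) (at q within {t - d..t + d})"
          unfolding D_def D'_def
          using solves_onD(2)[OF X q'] solves_onD(2)[OF Y(2)[of n] q'] W(2)[OF q']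
          by (intro derivative_intros bounded_linear.has_vector_derivative[OF bounded_linear_scaleR_right]) (auto simp: I_def)
        have "norm (u (Y n q, q) - u (X q, q) - A (X q, q) (Y n q - X q)) \<le> e' * norm (Y n q - X q)"
          using solves_onD(1)[OF X q'] solves_onD(1)[OF Y(2)[of n] q'] near[OF q', of n] n
          by (intro \<eta>(2) q') auto
        also have "\<dots> \<le> e' * (2 * norm v * \<bar>h n\<bar>)"
          using near[OF q', of n] e' by (intro mult_left_mono) auto
        finally have rem: "norm ((u (Y n q, q) - u (X q, q) - A (X q, q) (Y n q - X q)) /\<^sub>R h n) \<le> 2 * norm v * e'"
          using h(2)[of n] by (intro norm_scaleR_inverse_le) (auto simp: mult_ac)
        \<comment> \<open>Linearizing \<open>u\<close> around \<open>X q\<close> splits the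
          derivative of the error into a part linear in \<open>D q\<close> and the remainder bounded
          in \<open>rem\<close>.\<close>
        have eq: "D' q = A (X q, q) (D q) + (u (Y n q, q) - u (X q, q) - A (X q, q) (Y n q - X q)) /\<^sub>R h n"
          unfolding D_def D'_def by (simp add: blinfun.bilinear_simps algebra_simps)
        have "norm (A (X q, q) (D q)) \<le> norm (A (X q, q)) * norm (D q)"
          by (rule norm_blinfun)
        also have "\<dots> \<le> L * norm (D q)"
          using q' solves_onD(1)[OF X q'] by (intro mult_right_mono L) auto
        finally show "norm (D' q) \<le> L * norm (D q) + 2 * norm v * e'"
          unfolding eq using rem norm_triangle_mono by blast
      qed (use assms s e' in \<open>auto simp: I_def\<close>)
      also have "D t = 0"
        unfolding D_def using W(1) Y(1) h(2)[of n] by simp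
      also have "2 * (norm (0::'a) + 2 * norm v * e' * d) = e * (norm v / (2 * K))"
        unfolding e'_def using \<open>0 < d\<close> K(1) by (simp add: divide_simps)
      also have "\<dots> < e * 1"
        using \<open>0 < e\<close> K by (intro mult_strict_left_mono) (simp_all add: pos_divide_less_eq)
      finally show "dist ((Y n s - X s) /\<^sub>R h n) (W s) < e"
        unfolding D_def dist_norm by simp
    qed
  qed
  with near h Y W show ?thesis
    unfolding variation_of_def by auto
qed

text \<open>A chain rule that is uniform in time: \<open>g\<close> is linearized around
  \<open>X s\<close>, the remainder is of order \<open>e' * \<bar>h n\<bar>\<close>, and the bound
  on \<open>B\<close> carries over the uniform convergence of the trajectory quotients. It is later
  applied to the temperature, the velocity and the force.\<close>

lemma variation_difference_quotient:
  fixes g :: "'a::euclidean_space \<times> real \<Rightarrow> 'b::real_normed_vector"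
  assumes "compact S" "convex S" "compact I"
    and var: "variation_of u A S I t X v h Y W" and X: "solves_on u S I X"
    and B: "partial_derivative_on g B (S \<times> I)"
  shows "uniform_limit I (\<lambda>n s. (g (Y n s, s) - g (X s, s)) /\<^sub>R h n) (\<lambda>s. B (X s, s) (W s)) sequentially"
proof (rule uniform_limitI)
  fix e :: real assume "0 < e"
  note v = var[unfolded variation_of_def]
  obtain M where M: "0 < M" "\<And>z. z \<in> S \<times> I \<Longrightarrow> norm (B z) \<le> M"
    using bounded_on_compact[OF compact_Times[OF assms(1,3)] partial_derivative_onD(2)[OF B]] by metis
  define K where "K = norm v + 1"
  have K: "0 < K" "norm v < K"
    by (auto simp: K_def add_nonneg_pos)
  \<comment> \<open>Half of \<open>e\<close> is reserved for the remainder, at most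
    \<open>2 * norm v * e'\<close>, and half for the error of the trajectory quotient, taken below
    \<open>e / (2 * M)\<close>.\<close>
  define e' where "e' = e / (4 * K)"
  have e': "0 < e'"
    unfolding e'_def using \<open>0 < e\<close> K by simp
  obtain \<eta> where \<eta>: "0 < \<eta>"
    "\<And>x y s. x \<in> S \<Longrightarrow> y \<in> S \<Longrightarrow> s \<in> I \<Longrightarrow> norm (y - x) < \<eta> \<Longrightarrow>
       norm (g (y, s) - g (x, s) - B (x, s) (y - x)) \<le> e' * norm (y - x)"
    by (rule uniform_linearization[of S I g B e'])
      (use assms e' in \<open>auto dest: partial_derivative_onD\<close>)
  have "((\<lambda>n. 2 * norm v * \<bar>h n\<bar>) \<longlongrightarrow> 2 * norm v * \<bar>0\<bar>) sequentially"
    using v by (intro tendsto_intros) auto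
  then have "\<forall>\<^sub>F n in sequentially. 2 * norm v * \<bar>h n\<bar> < \<eta>"
    using \<eta>(1) by (simp add: order_tendstoD)
  moreover have "\<forall>\<^sub>F n in sequentially. \<forall>s\<in>I. dist ((Y n s - X s) /\<^sub>R h n) (W s) < e / (2 * M)"
    using v \<open>0 < e\<close> M(1) by (auto dest!: uniform_limitD[of _ _ _ _ "e / (2 * M)"])
  ultimately show "\<forall>\<^sub>F n in sequentially. \<forall>s\<in>I. dist ((g (Y n s, s) - g (X s, s)) /\<^sub>R h n) (B (X s, s) (W s)) < e"
  proof (eventually_elim, intro ballI)
    fix n s assume n: "2 * norm v * \<bar>h n\<bar> < \<eta>" and s: "s \<in> I"
      and Q: "\<forall>s\<in>I. dist ((Y n s - X s) /\<^sub>R h n) (W s) < e / (2 * M)"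
    have hn: "h n \<noteq> 0" and near: "norm (Y n s - X s) \<le> 2 * norm v * \<bar>h n\<bar>" and Y: "Y n s \<in> S"
      using v s solves_onD(1) by fast+
    have XS: "X s \<in> S"
      using X s by (rule solves_onD)
    have "norm (g (Y n s, s) - g (X s, s) - B (X s, s) (Y n s - X s)) \<le> e' * norm (Y n s - X s)"
      using near n by (intro \<eta>(2) s Y XS) auto
    also have "\<dots> \<le> e' * (2 * norm v * \<bar>h n\<bar>)"
      using near e' by (intro mult_left_mono) auto
    finally have "norm ((g (Y n s, s) - g (X s, s) - B (X s, s) (Y n s - X s)) /\<^sub>R h n) \<le> 2 * norm v * e'"
      using hn by (intro norm_scaleR_inverse_le) (auto simp: mult_ac)
    also have "\<dots> < e / 2"
      unfolding e'_def using \<open>0 < e\<close> K by (simp add: divide_simps)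
    finally have 1: "norm ((g (Y n s, s) - g (X s, s) - B (X s, s) (Y n s - X s)) /\<^sub>R h n) < e / 2" .
    have "norm (B (X s, s) ((Y n s - X s) /\<^sub>R h n - W s)) \<le> norm (B (X s, s)) * norm ((Y n s - X s) /\<^sub>R h n - W s)"
      by (rule norm_blinfun)
    also have "\<dots> \<le> M * norm ((Y n s - X s) /\<^sub>R h n - W s)"
      using XS s by (intro mult_right_mono M) auto
    also have "\<dots> < M * (e / (2 * M))"
      using Q s M(1) by (intro mult_strict_left_mono) (auto simp: dist_norm)
    also have "\<dots> = e / 2"
      using M(1) by simp
    finally have 2: "norm (B (X s, s) ((Y n s - X s) /\<^sub>R h n - W s)) < e / 2" .
    have "(g (Y n s, s) - g (X s, s)) /\<^sub>R h n - B (X s, s) (W s)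
      = (g (Y n s, s) - g (X s, s) - B (X s, s) (Y n s - X s)) /\<^sub>R h n + B (X s, s) ((Y n s - X s) /\<^sub>R h n - W s)"
      by (simp add: blinfun.bilinear_simps algebra_simps)
    then show "dist ((g (Y n s, s) - g (X s, s)) /\<^sub>R h n) (B (X s, s) (W s)) < e"
      using norm_triangle_lt[of "(g (Y n s, s) - g (X s, s) - B (X s, s) (Y n s - X s)) /\<^sub>R h n"
          "B (X s, s) ((Y n s - X s) /\<^sub>R h n - W s)" e] 1 2
      by (simp add: dist_norm)
  qed
qed

text \<open>The trajectory \<open>X\<close> is prescribed here, so the time interval is shortened
  until \<open>X\<close> stays in the ball of \<open>local_solutions\<close>; neighbouring solutions
  and \<open>W\<close> then come from the existence results.\<close>

lemma variations_exist:
  fixes u :: "'a::euclidean_space \<times> real \<Rightarrow> 'a"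
  assumes "open \<Omega>" "(X t, t) \<in> \<Omega>" and u: "continuous_on \<Omega> u" and A: "partial_derivative_on u A \<Omega>"
    and X: "\<forall>\<^sub>F s in nhds t. (X has_vector_derivative u (X s, s)) (at s)"
  obtains S d where "0 < d" "compact S" "convex S" "S \<times> {t - d..t + d} \<subseteq> \<Omega>"
    "solves_on u S {t - d..t + d} X"
    "\<And>v. \<exists>h Y W. variation_of u A S {t - d..t + d} t X v h Y W"
proof -
  obtain r d0 L where rd: "0 < r" "0 < d0" "0 \<le> L" "L * d0 \<le> 1 / 2"
    "cball (X t) r \<times> {t - d0..t + d0} \<subseteq> \<Omega>"
    "\<forall>z\<in>cball (X t) r \<times> {t - d0..t + d0}. norm (A z) \<le> L"
    "\<forall>d' b. 0 < d' \<and> d' \<le> d0 \<and> b \<in> cball (X t) (r / 2) \<longrightarrow>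
        (\<exists>Y. Y t = b \<and> solves_on u (cball (X t) r) {t - d'..t + d'} Y)"
    by (rule local_solutions[OF assms(1-4)], rule that)
  have "isCont X t"
    using eventually_nhds_x_imp_x[OF X] by (rule has_vector_derivative_continuous)
  then have "\<forall>\<^sub>F s in nhds t. dist (X s) (X t) < r"
    using rd(1) by (simp add: continuous_at_eps_delta eventually_nhds_metric)
  from eventually_conj[OF X this] obtain d1 where d1: "0 < d1"
    "\<And>s. dist s t < d1 \<Longrightarrow> (X has_vector_derivative u (X s, s)) (at s) \<and> dist (X s) (X t) < r"
    unfolding eventually_nhds_metric by auto
  \<comment> \<open>Halving \<open>d1\<close> makes the closed interval fit into the open
    neighbourhood of \<open>t\<close> on which \<open>X\<close> is controlled.\<close>
  define d where "d = min d0 (d1 / 2)"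
  have d: "0 < d" "d \<le> d0" "d < d1"
    using rd d1 by (auto simp: d_def)
  let ?I = "{t - d..t + d}" and ?S = "cball (X t) r"
  have sub: "?S \<times> ?I \<subseteq> ?S \<times> {t - d0..t + d0}"
    using d by (intro Sigma_mono) auto
  have Ld: "L * d \<le> 1 / 2"
    using rd(3,4) d(2) mult_left_mono[of d d0 L] by linarith
  have XI: "solves_on u ?S ?I X"
    unfolding solves_on_def
  proof (intro ballI conjI)
    fix s assume "s \<in> ?I"
    then have "dist s t < d1"
      using d(3) by (auto simp: dist_real_def abs_if)
    from d1(2)[OF this] show "X s \<in> ?S" "(X has_vector_derivative u (X s, s)) (at s within ?I)"
      by (auto simp: dist_commute intro: has_vector_derivative_at_within)
  qed
  have AI: "partial_derivative_on u A (?S \<times> ?I)"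
    using A rd(5) sub by (blast intro: partial_derivative_on_subset)
  have "\<exists>h Y W. variation_of u A ?S ?I t X v h Y W" for v
  proof -
    define K where "K = norm v + 1"
    have K: "0 < K" "norm v \<le> K"
      by (auto simp: K_def add_nonneg_pos)
    \<comment> \<open>With this scale all starting points \<open>X t + h n *\<^sub>R v\<close> lie
      in the half ball where \<open>local_solutions\<close> applies.\<close>
    define c where "c = r / (2 * K)"
    have c: "0 < c" "c * norm v \<le> r / 2"
      using rd(1) K by (auto simp: c_def divide_simps)
    define h where "h n = c / real (Suc n)" for n
    have "h \<longlonglongrightarrow> 0"
      unfolding h_def by (rule LIMSEQ_Suc[OF lim_const_over_n])
    moreover have hn: "h n \<noteq> 0" for n
      unfolding h_def using c by simp
    moreover have "X t + h n *\<^sub>R v \<in> cball (X t) (r / 2)" for n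
    proof -
      have "\<bar>h n\<bar> \<le> c"
        unfolding h_def using c(1) by (simp add: field_simps)
      then show ?thesis
        using c(2) mult_right_mono[of "\<bar>h n\<bar>" c "norm v"] by (simp add: dist_norm)
    qed
    then have "\<exists>Y. Y t = X t + h n *\<^sub>R v \<and> solves_on u ?S ?I Y" for n
      using rd(7)[rule_format, of d "X t + h n *\<^sub>R v"] d by simp
    then obtain Y where "\<And>n. Y n t = X t + h n *\<^sub>R v" "\<And>n. solves_on u ?S ?I (Y n)"
      by metis
    \<comment> \<open>The linear equation for \<open>W\<close> is an instance of the same existence
      lemma, with the bound \<open>L\<close> on \<open>A\<close> as Lipschitz constant.\<close>
    moreover obtain W where "W t = v"
      "\<And>s. s \<in> ?I \<Longrightarrow> (W has_vector_derivative (\<lambda>(w, s). A (X s, s) w) (W s, s)) (at s within ?I)"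
    proof (rule short_time_ode_solution[of d L t "\<lambda>(w, s). A (X s, s) w" v])
      have "continuous_on ?I (\<lambda>s. A (X s, s))"
        by (rule continuous_on_compose2[OF partial_derivative_onD(2)[OF AI]])
          (use solves_onD(1)[OF XI] in \<open>auto intro!: continuous_intros solves_on_continuous[OF XI]\<close>)
      then have "continuous_on (UNIV \<times> ?I) (\<lambda>z. A (X (snd z), snd z))"
        by (rule continuous_on_compose2) (auto intro!: continuous_intros)
      then show "continuous_on (UNIV \<times> ?I) (\<lambda>(w, s). A (X s, s) w)"
        unfolding case_prod_beta by (intro continuous_intros)
      fix s x y assume s: "s \<in> ?I"
      have "(X s, s) \<in> ?S \<times> {t - d0..t + d0}"
        using solves_onD(1)[OF XI s] s d(2) by simp
      then have AL: "norm (A (X s, s)) \<le> L"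
        using rd(6) by blast
      have "norm (A (X s, s) (x - y)) \<le> norm (A (X s, s)) * norm (x - y)"
        by (rule norm_blinfun)
      also have "\<dots> \<le> L * norm (x - y)"
        using AL by (rule mult_right_mono) simp
      finally show "norm ((\<lambda>(w, s). A (X s, s) w) (x, s) - (\<lambda>(w, s). A (X s, s) w) (y, s)) \<le> L * norm (x - y)"
        by (simp add: blinfun.diff_right)
    qed (use d rd Ld in auto)
    ultimately have "variation_of u A ?S ?I t X v h Y W"
      by (intro solutions_difference_quotient[where L=L]) (use d rd Ld AI XI sub in auto)
    then show ?thesis
      by blast
  qed
  then show ?thesis
    using d(1) order_trans[OF sub rd(5)] XI by (intro that[of d ?S]) simp_all
qed

section \<open>Symmetry of the second derivative\<close>

text \<open>The mean value theorem in direction \<open>v\<close> turns the second difference into an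
  increment of \<open>g\<close>, and differentiability of \<open>g\<close> at the single point
  \<open>x\<close> evaluates that increment to first order.\<close>

lemma second_difference_limit:
  fixes f :: "'a::real_inner \<Rightarrow> real" and g :: "'a \<Rightarrow> 'a"
  assumes f: "\<And>y. (f has_derivative (\<lambda>h. g y \<bullet> h)) (at y)"
    and g: "(g has_derivative H) (at x)"
  shows "((\<lambda>h. (f (x + h *\<^sub>R v + h *\<^sub>R w) - f (x + h *\<^sub>R v) - f (x + h *\<^sub>R w) + f x) / h\<^sup>2) \<longlongrightarrow> H w \<bullet> v)
     (at_right 0)"
proof (rule tendstoI)
  fix e :: real assume "0 < e"
  interpret H: bounded_linear H
    using g by (rule has_derivative_bounded_linear)
  \<comment> \<open>Chosen so that the errors collected at the end amount to
    \<open>e / K * h * (K - 1)\<close>, which is below \<open>e * h\<close>.\<close>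
  define K where "K = (2 * norm v + norm w) * norm v + 1"
  have K: "0 < K"
    unfolding K_def by (intro add_nonneg_pos mult_nonneg_nonneg add_nonneg_nonneg) auto
  obtain \<eta> where \<eta>: "0 < \<eta>" "\<And>y. norm (y - x) < \<eta> \<Longrightarrow> norm (g y - g x - H (y - x)) \<le> e / K * norm (y - x)"
    using g \<open>0 < e\<close> K unfolding has_derivative_at_alt by (metis divide_pos_pos)
  have "\<forall>\<^sub>F h in at_right 0. h * (norm v + norm w) < \<eta>"
  proof -
    have "((\<lambda>h. h * (norm v + norm w)) \<longlongrightarrow> 0) (at_right 0)"
      by (intro tendsto_eq_intros) auto
    then show ?thesis
      using \<eta>(1) by (rule order_tendstoD)
  qed
  then show "\<forall>\<^sub>F h in at_right 0. dist ((f (x + h *\<^sub>R v + h *\<^sub>R w) - f (x + h *\<^sub>R v) - f (x + h *\<^sub>R w) + f x) / h\<^sup>2) (H w \<bullet> v) < e"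
    using eventually_at_right_less[of 0]
  proof eventually_elim
    case (elim h)
    \<comment> \<open>The increment in direction \<open>w\<close>, as a function of the position
      along \<open>v\<close>: its own increment from 0 to 1 is the second difference.\<close>
    define \<phi> where "\<phi> r = f (x + (r * h) *\<^sub>R v + h *\<^sub>R w) - f (x + (r * h) *\<^sub>R v)" for r
    have "(\<phi> has_derivative (\<lambda>q. q * ((g (x + (r * h) *\<^sub>R v + h *\<^sub>R w) - g (x + (r * h) *\<^sub>R v)) \<bullet> (h *\<^sub>R v)))) (at r)" for r
      unfolding \<phi>_def
      by (rule derivative_eq_intros has_derivative_compose[OF _ f] refl | simp)+
        (auto simp: algebra_simps inner_simps)
    note \<phi>' = this
    have "continuous_on {0..1} \<phi>"
      using \<phi>' by (meson continuous_at_imp_continuous_on has_derivative_continuous)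
    then obtain r where r: "0 < r" "r < 1"
      "\<phi> 1 - \<phi> 0 = (g (x + (r * h) *\<^sub>R v + h *\<^sub>R w) - g (x + (r * h) *\<^sub>R v)) \<bullet> (h *\<^sub>R v)"
      using mvt[OF zero_less_one _ \<phi>'] by auto
    define a b where "a = (r * h) *\<^sub>R v + h *\<^sub>R w" and "b = (r * h) *\<^sub>R v"
    have rh: "\<bar>r * h\<bar> \<le> h"
      using r elim by (simp add: mult_left_le_one_le abs_mult)
    have nb: "norm b \<le> h * norm v"
      using rh by (auto simp: b_def intro!: mult_right_mono)
    have na: "norm a \<le> h * (norm v + norm w)"
      using nb norm_triangle_ineq[of b "h *\<^sub>R w"] elim by (simp add: a_def b_def algebra_simps)
    have nb': "norm b \<le> h * (norm v + norm w)"
      using nb elim by (smt (verit) mult_left_mono norm_ge_zero)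
    have 1: "norm (g (x + a) - g x - H a) \<le> e / K * norm a" "norm (g (x + b) - g x - H b) \<le> e / K * norm b"
      using \<eta>(2)[of "x + a"] \<eta>(2)[of "x + b"] na nb' elim by auto
    \<comment> \<open>The unknown intermediate point \<open>r\<close> drops out here, because
      \<open>a\<close> and \<open>b\<close> differ by \<open>h *\<^sub>R w\<close> only.\<close>
    have "H a - H b = h *\<^sub>R H w"
      by (simp add: a_def b_def H.add H.scaleR)
    then have eq: "g (x + a) - g (x + b) - h *\<^sub>R H w = (g (x + a) - g x - H a) - (g (x + b) - g x - H b)"
      by (simp add: algebra_simps)
    have "norm (g (x + a) - g (x + b) - h *\<^sub>R H w) \<le> e / K * norm a + e / K * norm b"
      unfolding eq using 1 norm_triangle_ineq4 by (smt (verit))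
    also have "\<dots> \<le> e / K * (h * (norm v + norm w)) + e / K * (h * norm v)"
      using na nb \<open>0 < e\<close> K by (intro add_mono mult_left_mono) auto
    finally have 2: "norm (g (x + a) - g (x + b) - h *\<^sub>R H w) \<le> e / K * h * (2 * norm v + norm w)"
      by (simp add: algebra_simps)
    have "f (x + h *\<^sub>R v + h *\<^sub>R w) - f (x + h *\<^sub>R v) - f (x + h *\<^sub>R w) + f x = h * ((g (x + a) - g (x + b)) \<bullet> v)"
      using r(3) by (simp add: \<phi>_def a_def b_def algebra_simps)
    then have "(f (x + h *\<^sub>R v + h *\<^sub>R w) - f (x + h *\<^sub>R v) - f (x + h *\<^sub>R w) + f x) / h\<^sup>2 - H w \<bullet> v
       = (g (x + a) - g (x + b) - h *\<^sub>R H w) \<bullet> v / h"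
      using elim by (simp add: power2_eq_square inner_diff_left diff_divide_distrib)
    moreover have "\<bar>(g (x + a) - g (x + b) - h *\<^sub>R H w) \<bullet> v / h\<bar> < e"
    proof -
      have "\<bar>(g (x + a) - g (x + b) - h *\<^sub>R H w) \<bullet> v\<bar> \<le> e / K * h * (2 * norm v + norm w) * norm v"
        using Cauchy_Schwarz_ineq2 mult_right_mono[OF 2 norm_ge_zero[of v]] by (rule order_trans)
      also have "\<dots> = e / K * h * (K - 1)"
        by (simp add: K_def)
      also have "\<dots> < e * h"
        using elim \<open>0 < e\<close> K by (simp add: field_simps)
      finally show ?thesis
        using elim by (simp add: field_simps)
    qed
    ultimately show ?case
      by (simp add: dist_real_def)
  qed
qed

text \<open>The second difference is unchanged when \<open>v\<close> and \<open>w\<close> are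
  exchanged, so both sides are limits of the same quotient.\<close>

lemma second_derivative_symmetric:
  fixes f :: "'a::real_inner \<Rightarrow> real" and g :: "'a \<Rightarrow> 'a"
  assumes f: "\<And>y. (f has_derivative (\<lambda>h. g y \<bullet> h)) (at y)"
    and g: "(g has_derivative H) (at x)"
  shows "H w \<bullet> v = H v \<bullet> w"
proof (rule tendsto_unique)
  show "((\<lambda>h. (f (x + h *\<^sub>R v + h *\<^sub>R w) - f (x + h *\<^sub>R v) - f (x + h *\<^sub>R w) + f x) / h\<^sup>2) \<longlongrightarrow> H v \<bullet> w)
     (at_right 0)"
    using second_difference_limit[OF assms, of w v] by (simp add: algebra_simps)
qed (use second_difference_limit[OF assms, of v w] in auto)

section \<open>Partial derivatives on the slab\<close>

lemma open_slab: "open (slab T)"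
  unfolding slab_def by (intro open_Times) auto

lemma mem_slab: "(x, s) \<in> slab T \<longleftrightarrow> 0 < s \<and> s < T"
  by (simp add: slab_def)

lemma dx_spatial:
  assumes "((\<lambda>y. f (y, t)) has_derivative D) (at x)"
  shows "dx j f (x, t) = D (axis j 1)"
proof -
  interpret D: bounded_linear D
    using assms by (rule has_derivative_bounded_linear)
  have "((\<lambda>h. x + h *\<^sub>R axis j 1) has_derivative (\<lambda>h. h *\<^sub>R axis j 1)) (at 0)"
    by (auto intro!: derivative_eq_intros)
  from has_derivative_compose[OF this, of "\<lambda>y. f (y, t)" D] assms
  have "((\<lambda>h. f (x + h *\<^sub>R axis j 1, t)) has_derivative (\<lambda>h. D (h *\<^sub>R axis j 1))) (at 0)"
    by simp
  then show ?thesis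
    unfolding dx_def by (simp add: has_vector_derivative_def vector_derivative_at D.scaleR)
qed

text \<open>Chain rule for the space-time curve with velocity \<open>(u, 1)\<close>: linearity
  splits its image under \<open>F\<close> into the time part and the convective part. The derivative
  within \<open>I\<close> also serves the endpoints of a closed interval.\<close>

lemma has_derivative_along:
  fixes f :: "(real ^ 2) \<times> real \<Rightarrow> 'b::real_normed_vector"
  assumes f: "(f has_derivative F) (at (Y s, s))"
    and Y: "(Y has_vector_derivative u (Y s, s)) (at s within I)"
  shows "((\<lambda>s. f (Y s, s)) has_vector_derivative dt f (Y s, s) + convective u f (Y s, s)) (at s within I)"
proof -
  interpret F: bounded_linear F
    using f by (rule has_derivative_bounded_linear)
  have "((\<lambda>y. (y, s)) has_derivative (\<lambda>h. (h, 0))) (at (Y s))"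
    by (auto intro!: derivative_eq_intros)
  from has_derivative_compose[OF this, of f F] f
  have dx: "dx j f (Y s, s) = F (axis j 1, 0)" for j
    by (intro dx_spatial) simp
  have dt: "dt f (Y s, s) = F (0, 1)"
  proof -
    have "((\<lambda>s'. f (Y s, s')) has_derivative (\<lambda>h. F (0, h))) (at s)"
      using has_derivative_compose[OF has_derivative_Pair[OF has_derivative_const has_derivative_ident] f]
      by simp
    moreover have "(\<lambda>h. F (0, h)) = (\<lambda>h. h *\<^sub>R F (0, 1))"
      by (rule ext) (simp flip: F.scaleR)
    ultimately show ?thesis
      unfolding dt_def by (simp add: has_vector_derivative_def vector_derivative_at)
  qed
  have "(u (Y s, s), 1) = (0, 1) + (\<Sum>j\<in>UNIV. (u (Y s, s) $ j) *\<^sub>R (axis j 1, 0::real))"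
    by (simp add: sum_2 prod_eq_iff vec_eq_iff axis_def forall_2)
  then have sum: "F (u (Y s, s), 1) = dt f (Y s, s) + convective u f (Y s, s)"
    unfolding convective_def dx dt by (simp only: F.add F.sum F.scaleR)
  have "((\<lambda>s. (Y s, s)) has_vector_derivative (u (Y s, s), 1)) (at s within I)"
    using Y by (intro has_vector_derivative_Pair) auto
  then have "((f \<circ> (\<lambda>s. (Y s, s))) has_vector_derivative F (u (Y s, s), 1)) (at s within I)"
    by (rule vector_derivative_diff_chain_within) (use f in \<open>auto intro: has_derivative_at_withinI\<close>)
  then show ?thesis
    by (simp add: o_def sum)
qed

lemma C1_on_has_derivative:
  assumes "C1_on f S" "z \<in> S"
  obtains F where "(f has_derivative F) (at z)"
  using assms unfolding C1_on_def by blast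

lemma C1_on_continuous: "C1_on f S \<Longrightarrow> continuous_on S f"
  by (meson C1_on_has_derivative continuous_at_imp_continuous_on has_derivative_continuous)

lemma C1_on_partial_derivative:
  fixes f :: "(real ^ 2) \<times> real \<Rightarrow> 'b::real_normed_vector"
  assumes "C1_on f S"
  obtains A where "partial_derivative_on f A S" "\<And>z v. z \<in> S \<Longrightarrow> A z v = (\<Sum>j\<in>UNIV. v $ j *\<^sub>R dx j f z)"
proof -
  obtain f' where f': "\<And>z. z \<in> S \<Longrightarrow> (f has_derivative blinfun_apply (f' z)) (at z)" "continuous_on S f'"
    using assms unfolding C1_on_def by blast
  \<comment> \<open>Composition with the embedding of space directions restricts the space-time
    derivative to space and preserves continuity in operator norm.\<close>
  define E :: "(real ^ 2) \<Rightarrow>\<^sub>L ((real ^ 2) \<times> real)" where "E = Blinfun (\<lambda>h. (h, 0))"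
  have E: "E h = (h, 0)" for h
    unfolding E_def by (subst bounded_linear_Blinfun_apply) (auto intro: bounded_linear_intros)
  define A where "A z = f' z o\<^sub>L E" for z
  have der: "((\<lambda>y. f (y, s)) has_derivative A (x, s)) (at x)" if "(x, s) \<in> S" for x s
  proof -
    have "((\<lambda>y. (y, s)) has_derivative (\<lambda>h. (h, 0))) (at x)"
      by (auto intro!: derivative_eq_intros)
    from has_derivative_compose[OF this, of f "f' (x, s)"] f'(1)[OF that]
    show ?thesis
      by (simp add: A_def E blinfun_compose.rep_eq o_def)
  qed
  moreover have "continuous_on S A"
    unfolding A_def by (intro continuous_intros f')
  ultimately have "partial_derivative_on f A S"
    unfolding partial_derivative_on_def by auto
  moreover have "A z v = (\<Sum>j\<in>UNIV. v $ j *\<^sub>R dx j f z)" if "z \<in> S" for z v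
  proof -
    obtain x s where z: "z = (x, s)"
      by (cases z)
    have "dx j f z = A z (axis j 1)" for j
      using dx_spatial[OF der] that unfolding z by blast
    moreover have "v = (\<Sum>j\<in>UNIV. v $ j *\<^sub>R axis j 1)"
      by (simp add: sum_2 vec_eq_iff axis_def forall_2)
    then have "A z v = (\<Sum>j\<in>UNIV. v $ j *\<^sub>R A z (axis j 1))"
      by (metis (no_types, lifting) blinfun.scaleR_right blinfun.sum_right sum.cong)
    ultimately show ?thesis
      by simp
  qed
  ultimately show ?thesis
    by (rule that)
qed

text \<open>\<open>dx\<close> differentiates in the increment at 0; the shift by \<open>c\<close>
  expresses it as a derivative in the coordinate at its actual value, as needed for functions of two
  coordinates.\<close>

lemma has_vector_derivative_dx:
  assumes "dx_exists j f (x, t)"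
  shows "((\<lambda>a. f (x + (a - c) *\<^sub>R axis j 1, t)) has_vector_derivative dx j f (x, t)) (at c)"
proof -
  have "((\<lambda>h. f (x + h *\<^sub>R axis j 1, t)) has_vector_derivative dx j f (x, t)) (at 0)"
    using assms unfolding dx_exists_def dx_def by (simp add: vector_derivative_works)
  then have "((\<lambda>h. f (x + h *\<^sub>R axis j 1, t)) has_vector_derivative dx j f (x, t)) (at (c - c))"
    by simp
  moreover have "((\<lambda>a. a - c) has_vector_derivative 1) (at c)"
    by (auto intro!: derivative_eq_intros)
  ultimately have "(((\<lambda>h. f (x + h *\<^sub>R axis j 1, t)) \<circ> (\<lambda>a. a - c)) has_vector_derivative 1 *\<^sub>R dx j f (x, t)) (at c)"
    by (intro vector_diff_chain_at)
  then show ?thesis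
    by (simp add: o_def)
qed

text \<open>The criterion that partial derivatives, with continuity in the second direction, give a
  total derivative.\<close>

lemma has_derivative_from_dx:
  fixes f :: "(real ^ 2) \<times> real \<Rightarrow> 'b::real_normed_vector"
  assumes ex: "\<And>x j. dx_exists j f (x, t)"
    and cont: "continuous_on UNIV (\<lambda>x. dx 2 f (x, t))"
  shows "((\<lambda>y. f (y, t)) has_derivative (\<lambda>h. \<Sum>j\<in>UNIV. h $ j *\<^sub>R dx j f (x, t))) (at x)"
proof -
  \<comment> \<open>The criterion concerns functions on a product; \<open>e\<close> rebuilds the
    vector from its two coordinates.\<close>
  define e where "e a b = a *\<^sub>R axis 1 1 + b *\<^sub>R (axis 2 1 :: real ^ 2)" for a b :: real
  have e: "e (y $ 1) (y $ 2) = y" for y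
    by (simp add: e_def vec_eq_iff axis_def forall_2)
  have ce: "continuous_on UNIV (\<lambda>(a, b). e a b)"
    unfolding e_def case_prod_beta by (intro continuous_intros)
  have "((\<lambda>(a, b). f (e a b, t)) has_derivative
     (\<lambda>(ta, tb). ta *\<^sub>R dx 1 f (x, t) + blinfun_scaleR_left (dx 2 f (e (x $ 1) (x $ 2), t)) tb))
     (at (x $ 1, x $ 2) within UNIV \<times> UNIV)"
  proof (rule has_derivative_partialsI)
    show "((\<lambda>a. f (e a (x $ 2), t)) has_derivative (\<lambda>ta. ta *\<^sub>R dx 1 f (x, t))) (at (x $ 1))"
    proof -
      have "x + (a - x $ 1) *\<^sub>R axis 1 1 = e a (x $ 2)" for a
        by (simp add: e_def vec_eq_iff axis_def forall_2)
      then show ?thesis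
        using has_vector_derivative_dx[of 1 f x t "x $ 1", OF ex] by (simp add: has_vector_derivative_def)
    qed
    show "((\<lambda>b. f (e a b, t)) has_derivative blinfun_apply (blinfun_scaleR_left (dx 2 f (e a b, t)))) (at b)" for a b
    proof -
      have "e a b + (b' - b) *\<^sub>R axis 2 1 = e a b'" for b'
        by (simp add: e_def vec_eq_iff axis_def forall_2)
      then show ?thesis
        using has_vector_derivative_dx[of 2 f "e a b" t b, OF ex] by (simp add: has_vector_derivative_def)
    qed
    have "continuous_on UNIV (\<lambda>(a, b). blinfun_scaleR_left (dx 2 f (e a b, t)))"
      using continuous_on_compose2[OF cont ce]
      unfolding case_prod_beta by (intro continuous_intros) auto
    then show "continuous (at (x $ 1, x $ 2) within UNIV \<times> UNIV) (\<lambda>(a, b). blinfun_scaleR_left (dx 2 f (e a b, t)))"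
      by (simp add: continuous_on_eq_continuous_at)
  qed auto
  then have "((\<lambda>(a, b). f (e a b, t)) has_derivative (\<lambda>(ta, tb). ta *\<^sub>R dx 1 f (x, t) + tb *\<^sub>R dx 2 f (x, t)))
     (at (x $ 1, x $ 2))"
    by (simp add: e)
  moreover have "((\<lambda>y. (y $ 1, y $ 2)) has_derivative (\<lambda>h. (h $ 1, h $ 2))) (at x)"
    by (auto intro!: derivative_intros bounded_linear.has_derivative[OF bounded_linear_vec_nth])
  ultimately show ?thesis
    using has_derivative_compose[of "\<lambda>y. (y $ 1, y $ 2)" "\<lambda>h. (h $ 1, h $ 2)" x UNIV "\<lambda>(a, b). f (e a b, t)"
       "\<lambda>(ta, tb). ta *\<^sub>R dx 1 f (x, t) + tb *\<^sub>R dx 2 f (x, t)"]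
    by (simp add: e sum_2)
qed

lemma vector_has_derivative:
  fixes f :: "'a::real_normed_vector \<Rightarrow> real ^ 'n"
  assumes "\<And>i. ((\<lambda>x. f x $ i) has_derivative (\<lambda>h. f' h $ i)) (at x)"
  shows "(f has_derivative f') (at x)"
  unfolding has_derivative_componentwise_within[of f]
  using assms by (auto simp: Basis_vec_def simp flip: cart_eq_inner_axis)

text \<open>Continuous second partials make each \<open>dx j p\<close> totally differentiable in
  space. The resulting derivative \<open>D\<close> of the gradient is the transpose of
  \<open>hessian\<close>, so symmetry of the second derivative is needed to reach the stated
  form.\<close>

lemma grad_has_derivative_hessian:
  assumes p: "C1_on p (slab T)" and H: "continuous_hessian_on p (slab T)" and z: "(x, t) \<in> slab T"
  shows "((\<lambda>y. grad p (y, t)) has_derivative (\<lambda>h. hessian p (x, t) *v h)) (at x)"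
proof -
  have sl: "(y, t) \<in> slab T" for y
    using z by (simp add: mem_slab)
  have ch: "continuous_on UNIV (\<lambda>x. hessian p (x, t))"
    using H unfolding continuous_hessian_on_def
    by (auto intro!: continuous_on_compose2[of "slab T" "hessian p" UNIV "\<lambda>x. (x, t)"] continuous_intros simp: sl)
  have "continuous_on UNIV (\<lambda>x. hessian p (x, t) $ i $ j)" for i j
    by (intro continuous_intros ch)
  then have c: "continuous_on UNIV (\<lambda>x. dx i (dx j p) (x, t))" for i j
    by (simp add: hessian_def)
  have ex: "dx_exists i (dx j p) (x, t)" for i j x
    using H sl unfolding continuous_hessian_on_def by blast
  have dj: "((\<lambda>y. dx j p (y, t)) has_derivative (\<lambda>h. \<Sum>i\<in>UNIV. h $ i *\<^sub>R dx i (dx j p) (x, t))) (at x)" for j x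
    by (rule has_derivative_from_dx[OF ex c])
  define D where "D h = (\<chi> j. \<Sum>i\<in>UNIV. h $ i *\<^sub>R dx i (dx j p) (x, t))" for h
  have D: "((\<lambda>y. grad p (y, t)) has_derivative D) (at x)"
    by (rule vector_has_derivative) (use dj in \<open>simp add: grad_def D_def\<close>)
  obtain A where A: "partial_derivative_on p A (slab T)"
    "\<And>z v. z \<in> slab T \<Longrightarrow> A z v = (\<Sum>j\<in>UNIV. v $ j *\<^sub>R dx j p z)"
    using C1_on_partial_derivative[OF p] by metis
  have "((\<lambda>y. p (y, t)) has_derivative (\<lambda>h. grad p (y, t) \<bullet> h)) (at y)" for y
  proof -
    have "blinfun_apply (A (y, t)) = (\<lambda>h. grad p (y, t) \<bullet> h)"
      using A(2)[OF sl] by (auto simp: grad_def inner_vec_def mult.commute)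
    then show ?thesis
      using partial_derivative_onD(1)[OF A(1) sl, of y] by simp
  qed
  from second_derivative_symmetric[OF this D]
  have "D (axis i 1) $ j = D (axis j 1) $ i" for i j
    by (simp add: cart_eq_inner_axis)
  moreover have "D (axis i 1) $ j = hessian p (x, t) $ i $ j" for i j
    using exhaust_2[of i] by (auto simp: D_def hessian_def axis_def sum_2)
  ultimately have sym: "hessian p (x, t) $ i $ j = hessian p (x, t) $ j $ i" for i j
    by metis
  have "D = (\<lambda>h. hessian p (x, t) *v h)"
  proof
    fix h
    have "D h $ j = (hessian p (x, t) *v h) $ j" for j
      using sym[of 1 2] sym[of 2 1] exhaust_2[of j]
      by (auto simp: D_def matrix_vector_mult_def sum_2 hessian_def mult.commute)
    then show "D h = hessian p (x, t) *v h"
      by (simp add: vec_eq_iff)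
  qed
  then show ?thesis
    using D by simp
qed

lemma matrix_blinfun_continuous:
  fixes M :: "'c::t2_space \<Rightarrow> real ^ 'n ^ 'm"
  assumes "continuous_on S M"
  obtains B where "continuous_on S B" "\<And>z v. blinfun_apply (B z) v = M z *v v"
proof -
  define B where "B z = Blinfun (\<lambda>v. M z *v v)" for z
  have B: "blinfun_apply (B z) v = M z *v v" for z v
    unfolding B_def by (subst bounded_linear_Blinfun_apply) (auto intro: matrix_vector_mul_bounded_linear)
  have "continuous_on S B"
    by (rule continuous_on_blinfun_componentwise)
      (auto simp: B matrix_vector_mult_def intro!: continuous_intros assms)
  then show ?thesis
    using B by (rule that)
qed

lemma grad_partial_derivative:
  assumes p: "C1_on p (slab T)" and H: "continuous_hessian_on p (slab T)"
  obtains B where "partial_derivative_on (grad p) B (slab T)" "\<And>z v. blinfun_apply (B z) v = hessian p z *v v"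
proof -
  obtain B where B: "continuous_on (slab T) B" "\<And>z v. blinfun_apply (B z) v = hessian p z *v v"
    using H matrix_blinfun_continuous[of "slab T" "hessian p"] unfolding continuous_hessian_on_def by metis
  have "blinfun_apply (B z) = (\<lambda>v. hessian p z *v v)" for z
    by (rule ext) (rule B(2))
  then have "partial_derivative_on (grad p) B (slab T)"
    unfolding partial_derivative_on_def using B(1) grad_has_derivative_hessian[OF p H] by auto
  then show ?thesis
    using B(2) by (rule that)
qed

section \<open>Evolution along trajectories\<close>

lemma solves_on_trajectory:
  assumes "solves_on u S {t - d..t + d} X" "0 < d"
  shows "trajectory_through u (X t, t) X"
proof -
  have "\<forall>\<^sub>F s in nhds t. s \<in> {t - d<..<t + d}"
    using assms(2) by (intro eventually_nhds_in_open) auto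
  then have "\<forall>\<^sub>F s in nhds t. (X has_vector_derivative u (X s, s)) (at s)"
  proof eventually_elim
    case (elim s)
    then show ?case
      using solves_onD(2)[OF assms(1), of s] at_within_Icc_at[of "t - d" s "t + d"] by simp
  qed
  then show ?thesis
    unfolding trajectory_through_def by simp
qed

text \<open>Termwise differentiation: uniform convergence of the derivatives yields a differentiable
  limit, which uniqueness of limits identifies with \<open>V\<close>.\<close>

lemma uniform_limit_vector_derivative:
  fixes Z :: "nat \<Rightarrow> real \<Rightarrow> 'a::banach"
  assumes "convex I"
    and der: "\<And>n s. s \<in> I \<Longrightarrow> (Z n has_vector_derivative Z' n s) (at s within I)"
    and lim': "uniform_limit I Z' G sequentially"
    and lim: "\<And>s. s \<in> I \<Longrightarrow> (\<lambda>n. Z n s) \<longlonglongrightarrow> V s"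
    and s: "s \<in> I"
  shows "(V has_vector_derivative G s) (at s within I)"
proof -
  have "\<exists>g. \<forall>s\<in>I. (\<lambda>n. Z n s) \<longlonglongrightarrow> g s \<and> (g has_derivative (\<lambda>k. k *\<^sub>R G s)) (at s within I)"
  proof (rule has_derivative_sequence[where f=Z and ?x0.0=s and l="V s"])
    show "(Z n has_derivative (\<lambda>k. k *\<^sub>R Z' n q)) (at q within I)" if "q \<in> I" for n q
      using der[OF that] by (simp add: has_vector_derivative_def)
    fix e :: real assume "0 < e"
    then have "\<forall>\<^sub>F n in sequentially. \<forall>q\<in>I. dist (Z' n q) (G q) < e"
      using lim' by (simp add: uniform_limitD)
    then show "\<forall>\<^sub>F n in sequentially. \<forall>q\<in>I. \<forall>k. norm (k *\<^sub>R Z' n q - k *\<^sub>R G q) \<le> e * norm k"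
    proof (eventually_elim, intro ballI allI)
      fix n q and k :: real assume "\<forall>q\<in>I. dist (Z' n q) (G q) < e" "q \<in> I"
      then have "\<bar>k\<bar> * norm (Z' n q - G q) \<le> \<bar>k\<bar> * e"
        by (intro mult_left_mono) (auto simp: dist_norm less_imp_le)
      then show "norm (k *\<^sub>R Z' n q - k *\<^sub>R G q) \<le> e * norm k"
        by (simp add: mult.commute flip: scaleR_diff_right)
    qed
  qed (use \<open>convex I\<close> s lim in auto)
  then obtain g where g: "\<And>s. s \<in> I \<Longrightarrow> (\<lambda>n. Z n s) \<longlonglongrightarrow> g s"
    "\<And>s. s \<in> I \<Longrightarrow> (g has_vector_derivative G s) (at s within I)"
    by (auto simp: has_vector_derivative_def)
  have "g q = V q" if "q \<in> I" for q
    using g(1)[OF that] lim[OF that] by (rule LIMSEQ_unique)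
  then show ?thesis
    using has_vector_derivative_weaken[OF g(2)[OF s] s subset_refl] by blast
qed

lemma constant_on_zero_vector_derivative:
  fixes f :: "real \<Rightarrow> 'a::real_normed_vector"
  assumes "convex I" "\<And>s. s \<in> I \<Longrightarrow> (f has_vector_derivative 0) (at s within I)" "s \<in> I" "t \<in> I"
  shows "f s = f t"
  using vector_differentiable_bound[of I f "\<lambda>_. 0" 0 s t] assms by simp

lemma matrix_vector_mult_combination:
  fixes M :: "real ^ 'n ^ 'm"
  shows "M *v (a *\<^sub>R x - b *\<^sub>R y) = a *\<^sub>R (M *v x) - b *\<^sub>R (M *v y)"
  by (simp add: matrix_vector_mult_def vec_eq_iff sum_subtractf sum_distrib_left algebra_simps)

section \<open>Trajectories and linearized trajectories of a Boussinesq solution\<close>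

locale boussinesq_solution =
  fixes u :: "(real ^ 2) \<times> real \<Rightarrow> real ^ 2" and p \<theta> :: "(real ^ 2) \<times> real \<Rightarrow> real" and T :: real
  assumes u_C1: "C1_on u (slab T)" and p_C1: "C1_on p (slab T)" and theta_C1: "C1_on \<theta> (slab T)"
    and equations: "boussinesq_2d u p \<theta> T"
    and p_hessian: "continuous_hessian_on p (slab T)"
begin

lemma equationsD:
  assumes "z \<in> slab T"
  shows "dt u z + convective u u z = - grad p z + \<theta> z *\<^sub>R axis 2 1"
    and "dt \<theta> z + convective u \<theta> z = 0" and "divergence u z = 0"
proof -
  have *: "dt u z + convective u u z = - grad p z + \<theta> z *\<^sub>R axis 2 1 \<and>
      dt \<theta> z + convective u \<theta> z = 0 \<and> divergence u z = 0"
    using equations assms unfolding boussinesq_2d_def by (rule bspec)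
  show "dt u z + convective u u z = - grad p z + \<theta> z *\<^sub>R axis 2 1"
    using * by (rule conjunct1)
  show "dt \<theta> z + convective u \<theta> z = 0" "divergence u z = 0"
    using *[THEN conjunct2] by (rule conjunct1, rule conjunct2)
qed

lemma u_partial_derivative:
  obtains A where "partial_derivative_on u A (slab T)" "\<And>z v. z \<in> slab T \<Longrightarrow> A z v = vel_grad u z *v v"
proof -
  obtain A where A: "partial_derivative_on u A (slab T)"
    "\<And>z v. z \<in> slab T \<Longrightarrow> A z v = (\<Sum>j\<in>UNIV. v $ j *\<^sub>R dx j u z)"
    by (rule C1_on_partial_derivative[OF u_C1], rule that)
  have "A z v = vel_grad u z *v v" if z: "z \<in> slab T" for z v
  proof -
    obtain x t where zx: "z = (x, t)"
      by (cases z)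
    have D: "((\<lambda>y. u (y, t)) has_derivative A z) (at x)"
      using partial_derivative_onD(1)[OF A(1)] z unfolding zx by blast
    have "dx j (\<lambda>w. u w $ i) z = A z (axis j 1) $ i" for i j
      unfolding zx
      by (rule dx_spatial) (use bounded_linear.has_derivative[OF bounded_linear_vec_nth D] in \<open>simp add: zx\<close>)
    moreover have "dx j u z = A z (axis j 1)" for j
      using dx_spatial[OF D] by (simp add: zx)
    ultimately have "dx j (\<lambda>w. u w $ i) z = dx j u z $ i" for i j
      by simp
    then show ?thesis
      using A(2)[OF z] by (simp add: vel_grad_def matrix_vector_mult_def vec_eq_iff mult.commute)
  qed
  with A(1) show ?thesis
    by (rule that)
qed

lemma theta_partial_derivative:
  obtains A where "partial_derivative_on \<theta> A (slab T)" "\<And>z v. z \<in> slab T \<Longrightarrow> A z v = grad \<theta> z \<bullet> v"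
proof -
  obtain A where A: "partial_derivative_on \<theta> A (slab T)"
    "\<And>z v. z \<in> slab T \<Longrightarrow> A z v = (\<Sum>j\<in>UNIV. v $ j *\<^sub>R dx j \<theta> z)"
    by (rule C1_on_partial_derivative[OF theta_C1], rule that)
  have "A z v = grad \<theta> z \<bullet> v" if z: "z \<in> slab T" for z v
    using A(2)[OF z] by (simp add: grad_def inner_vec_def mult.commute)
  with A(1) show ?thesis
    by (rule that)
qed

lemma trajectory_exists:
  assumes "z \<in> slab T"
  obtains X where "trajectory_through u z X"
proof -
  obtain a t where z: "z = (a, t)"
    by (cases z)
  obtain A where A: "partial_derivative_on u A (slab T)"
    by (rule u_partial_derivative, rule that)
  obtain r d where r: "0 < r" "0 < d"
    and ex: "\<forall>d' b. 0 < d' \<and> d' \<le> d \<and> b \<in> cball a (r / 2) \<longrightarrow>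
        (\<exists>Y. Y t = b \<and> solves_on u (cball a r) {t - d'..t + d'} Y)"
    by (rule local_solutions[OF open_slab assms[unfolded z] C1_on_continuous[OF u_C1] A], rule that)
  obtain Y where Y: "Y t = a" "solves_on u (cball a r) {t - d..t + d} Y"
    using ex[rule_format, of d a] r by auto
  show ?thesis
    using that[of Y] solves_on_trajectory[OF Y(2) r(2)] by (simp add: Y(1) z)
qed

lemma theta_constant:
  assumes Y: "solves_on u S I Y" and "S \<times> I \<subseteq> slab T" "convex I" "s \<in> I" "t \<in> I"
  shows "\<theta> (Y s, s) = \<theta> (Y t, t)"
proof (rule constant_on_zero_vector_derivative[of I "\<lambda>s. \<theta> (Y s, s)"])
  fix s assume s: "s \<in> I"
  have in_slab: "(Y s, s) \<in> slab T"
    using solves_onD(1)[OF Y s] s assms(2) by blast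
  then obtain F where "(\<theta> has_derivative F) (at (Y s, s))"
    using C1_on_has_derivative[OF theta_C1] by metis
  from has_derivative_along[where Y=Y and s=s and u=u, OF this solves_onD(2)[OF Y s]]
  show "((\<lambda>s. \<theta> (Y s, s)) has_vector_derivative 0) (at s within I)"
    by (simp add: equationsD(2)[OF in_slab])
qed (use assms in auto)

lemma velocity_derivative:
  assumes Y: "solves_on u S I Y" and "S \<times> I \<subseteq> slab T" and s: "s \<in> I"
  shows "((\<lambda>s. u (Y s, s)) has_vector_derivative - grad p (Y s, s) + \<theta> (Y s, s) *\<^sub>R axis 2 1) (at s within I)"
proof -
  have in_slab: "(Y s, s) \<in> slab T"
    using solves_onD(1)[OF Y s] s assms(2) by blast
  then obtain F where "(u has_derivative F) (at (Y s, s))"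
    using C1_on_has_derivative[OF u_C1] by metis
  from has_derivative_along[where Y=Y and s=s and u=u, OF this solves_onD(2)[OF Y s]] show ?thesis
    by (simp add: equationsD(1)[OF in_slab])
qed

text \<open>The acceleration of a particle is differentiable in space, through the Hessian of
  \<open>p\<close> and the gradient of \<open>\<theta>\<close>. This allows its difference quotients
  to be handled by \<open>variation_difference_quotient\<close> without second derivatives of
  \<open>u\<close>.\<close>

lemma force_partial_derivative:
  obtains C where "partial_derivative_on (\<lambda>z. - grad p z + \<theta> z *\<^sub>R axis 2 1) C (slab T)"
    "\<And>z v. z \<in> slab T \<Longrightarrow> C z v = - (hessian p z *v v) + (grad \<theta> z \<bullet> v) *\<^sub>R axis 2 1"
proof -
  obtain B where B: "partial_derivative_on (grad p) B (slab T)" "\<And>z v. blinfun_apply (B z) v = hessian p z *v v"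
    by (rule grad_partial_derivative[OF p_C1 p_hessian], rule that)
  obtain A where A: "partial_derivative_on \<theta> A (slab T)" "\<And>z v. z \<in> slab T \<Longrightarrow> A z v = grad \<theta> z \<bullet> v"
    by (rule theta_partial_derivative, rule that)
  define C where "C z = - B z + (blinfun_scaleR_left (axis 2 1) o\<^sub>L A z)" for z
  have C: "C z v = - B z v + A z v *\<^sub>R axis 2 1" for z v
    by (simp add: C_def blinfun.bilinear_simps)
  have "((\<lambda>y. - grad p (y, s) + \<theta> (y, s) *\<^sub>R axis 2 1) has_derivative C (x, s)) (at x)" if "(x, s) \<in> slab T" for x s
  proof -
    have "((\<lambda>y. - grad p (y, s) + \<theta> (y, s) *\<^sub>R axis 2 1) has_derivative
        (\<lambda>v. - B (x, s) v + A (x, s) v *\<^sub>R axis 2 1)) (at x)"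
      using partial_derivative_onD(1)[OF A(1) that] partial_derivative_onD(1)[OF B(1) that]
      by (intro derivative_intros)
    moreover have "blinfun_apply (C (x, s)) = (\<lambda>v. - B (x, s) v + A (x, s) v *\<^sub>R axis 2 1)"
      by (rule ext) (rule C)
    ultimately show ?thesis
      by simp
  qed
  moreover have "continuous_on (slab T) C"
    unfolding C_def using partial_derivative_onD(2)[OF A(1)] partial_derivative_onD(2)[OF B(1)]
    by (intro continuous_intros)
  ultimately have "partial_derivative_on (\<lambda>z. - grad p z + \<theta> z *\<^sub>R axis 2 1) C (slab T)"
    unfolding partial_derivative_on_def by auto
  then show ?thesis
    by (rule that) (simp add: C A(2) B(2))
qed

text \<open>Both claims are limits of exact relations between \<open>X\<close> and the neighbouring
  trajectories: constancy of temperature for the first, the momentum equation for the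
  second.\<close>

lemma linearized_trajectory:
  assumes "0 < d" "compact S" "convex S" and sub: "S \<times> {t - d..t + d} \<subseteq> slab T"
    and X: "solves_on u S {t - d..t + d} X" and A: "partial_derivative_on u A (slab T)"
    and var: "variation_of u A S {t - d..t + d} t X v h Y W" and s: "s \<in> {t - d..t + d}"
  shows "grad \<theta> (X s, s) \<bullet> W s = grad \<theta> (X t, t) \<bullet> v"
    and "((\<lambda>s. A (X s, s) (W s)) has_vector_derivative
        - (hessian p (X s, s) *v W s) + (grad \<theta> (X t, t) \<bullet> v) *\<^sub>R axis 2 1) (at s within {t - d..t + d})"
proof -
  let ?I = "{t - d..t + d}"
  note quotient = variation_difference_quotient[OF assms(2,3) compact_Icc var X partial_derivative_on_subset[OF _ sub]]
  have tI: "t \<in> ?I"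
    using \<open>0 < d\<close> by auto
  have Y: "solves_on u S ?I (Y n)" for n
    using var unfolding variation_of_def by blast
  have X_slab: "(X q, q) \<in> slab T" if "q \<in> ?I" for q
    using solves_onD(1)[OF X that] that sub by blast
  obtain D where D: "partial_derivative_on \<theta> D (slab T)" "\<And>z v. z \<in> slab T \<Longrightarrow> D z v = grad \<theta> z \<bullet> v"
    by (rule theta_partial_derivative, rule that)
  have lim: "(\<lambda>n. (\<theta> (Y n q, q) - \<theta> (X q, q)) /\<^sub>R h n) \<longlonglongrightarrow> grad \<theta> (X q, q) \<bullet> W q" if "q \<in> ?I" for q
    using tendsto_uniform_limitI[OF quotient[OF D(1)] that] D(2)[OF X_slab[OF that]] by simp
  have const: "\<theta> (Y n q, q) - \<theta> (X q, q) = \<theta> (Y n t, t) - \<theta> (X t, t)" if "q \<in> ?I" for n q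
    using theta_constant[OF Y sub _ that tI] theta_constant[OF X sub _ that tI] by simp
  \<comment> \<open>The temperature quotients at times \<open>q\<close> and \<open>t\<close> are the
    same sequence, so their limits agree.\<close>
  have conserved: "grad \<theta> (X q, q) \<bullet> W q = grad \<theta> (X t, t) \<bullet> v" if "q \<in> ?I" for q
    using LIMSEQ_unique[OF lim[OF that, unfolded const[OF that]] lim[OF tI]] var
    unfolding variation_of_def by simp
  then show "grad \<theta> (X s, s) \<bullet> W s = grad \<theta> (X t, t) \<bullet> v"
    using s .
  obtain C where C: "partial_derivative_on (\<lambda>z. - grad p z + \<theta> z *\<^sub>R axis 2 1) C (slab T)"
    "\<And>z v. z \<in> slab T \<Longrightarrow> C z v = - (hessian p z *v v) + (grad \<theta> z \<bullet> v) *\<^sub>R axis 2 1"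
    by (rule force_partial_derivative, rule that)
  \<comment> \<open>The velocity quotients converge to \<open>A (X s, s) (W s)\<close>. Their time
    derivatives are force quotients, which converge uniformly to
    \<open>C (X s, s) (W s)\<close>.\<close>
  have "((\<lambda>s. A (X s, s) (W s)) has_vector_derivative C (X s, s) (W s)) (at s within ?I)"
  proof (rule uniform_limit_vector_derivative[OF _ _ quotient[OF C(1)] _ s])
    fix n q assume q: "q \<in> ?I"
    show "((\<lambda>s. (u (Y n s, s) - u (X s, s)) /\<^sub>R h n) has_vector_derivative
       ((- grad p (Y n q, q) + \<theta> (Y n q, q) *\<^sub>R axis 2 1) - (- grad p (X q, q) + \<theta> (X q, q) *\<^sub>R axis 2 1)) /\<^sub>R h n)
       (at q within ?I)"
      by (intro bounded_linear.has_vector_derivative[OF bounded_linear_scaleR_right]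
          has_vector_derivative_diff velocity_derivative[OF Y sub q] velocity_derivative[OF X sub q])
    show "(\<lambda>n. (u (Y n q, q) - u (X q, q)) /\<^sub>R h n) \<longlonglongrightarrow> A (X q, q) (W q)"
      by (rule tendsto_uniform_limitI[OF quotient[OF A] q])
  qed auto
  then show "((\<lambda>s. A (X s, s) (W s)) has_vector_derivative
        - (hessian p (X s, s) *v W s) + (grad \<theta> (X t, t) \<bullet> v) *\<^sub>R axis 2 1) (at s within ?I)"
    using C(2)[OF X_slab[OF s]] conserved[OF s] by simp
qed

lemma perp_grad_evolution:
  assumes z: "z \<in> slab T" and traj: "trajectory_through u z X"
  shows "((\<lambda>s. perp_grad \<theta> (X s, s)) has_vector_derivative U_perp_grad u \<theta> z) (at (snd z))"
    and "((\<lambda>s. U_perp_grad u \<theta> (X s, s)) has_vector_derivative - (hessian p z *v perp_grad \<theta> z)) (at (snd z))"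
proof -
  define t where "t = snd z"
  have zt: "z = (X t, t)" "snd z = t" and X': "\<forall>\<^sub>F s in nhds t. (X has_vector_derivative u (X s, s)) (at s)"
    using traj unfolding trajectory_through_def t_def by (auto simp: prod_eq_iff)
  obtain A where A: "partial_derivative_on u A (slab T)" "\<And>z v. z \<in> slab T \<Longrightarrow> A z v = vel_grad u z *v v"
    by (rule u_partial_derivative, rule that)
  obtain S d where S: "0 < d" "compact S" "convex S" "S \<times> {t - d..t + d} \<subseteq> slab T"
    and X: "solves_on u S {t - d..t + d} X"
    and var: "\<And>v. \<exists>h Y W. variation_of u A S {t - d..t + d} t X v h Y W"
    by (rule variations_exist[OF open_slab z[unfolded zt(1)] C1_on_continuous[OF u_C1] A(1) X'], rule that)
  let ?I = "{t - d..t + d}"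
  have tI: "t \<in> ?I"
    using S(1) by auto
  have X_slab: "(X q, q) \<in> slab T" if "q \<in> ?I" for q
    using solves_onD(1)[OF X that] that S(4) by blast
  define g where "g = grad \<theta> z"
  define lin where "lin v W \<longleftrightarrow> W t = v \<and> (\<forall>s\<in>?I.
      (W has_vector_derivative vel_grad u (X s, s) *v W s) (at s within ?I) \<and>
      grad \<theta> (X s, s) \<bullet> W s = g \<bullet> v \<and>
      ((\<lambda>s. A (X s, s) (W s)) has_vector_derivative
        - (hessian p (X s, s) *v W s) + (g \<bullet> v) *\<^sub>R axis 2 1) (at s within ?I))" for v W
  have ex: "\<exists>W. lin v W" for v
  proof -
    obtain h Y W where W: "variation_of u A S ?I t X v h Y W"
      using var by blast
    show ?thesis
      unfolding lin_def
    proof (intro exI[of _ W] conjI ballI)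
      show "W t = v"
        using W unfolding variation_of_def by blast
      fix s assume s: "s \<in> ?I"
      show "(W has_vector_derivative vel_grad u (X s, s) *v W s) (at s within ?I)"
        using W s unfolding variation_of_def A(2)[OF X_slab[OF s], symmetric] by blast
      show "grad \<theta> (X s, s) \<bullet> W s = g \<bullet> v"
        "((\<lambda>s. A (X s, s) (W s)) has_vector_derivative
          - (hessian p (X s, s) *v W s) + (g \<bullet> v) *\<^sub>R axis 2 1) (at s within ?I)"
        using linearized_trajectory[OF S X A(1) W s] unfolding g_def zt(1) .
    qed
  qed
  obtain W1 W2 where W12: "lin (axis 1 1) W1" "lin (axis 2 1) W2"
    using ex by metis
  have W: "W t = v"
    "s \<in> ?I \<Longrightarrow> (W has_vector_derivative vel_grad u (X s, s) *v W s) (at s within ?I)"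
    "s \<in> ?I \<Longrightarrow> grad \<theta> (X s, s) \<bullet> W s = g \<bullet> v"
    "s \<in> ?I \<Longrightarrow> ((\<lambda>s. A (X s, s) (W s)) has_vector_derivative
        - (hessian p (X s, s) *v W s) + (g \<bullet> v) *\<^sub>R axis 2 1) (at s within ?I)" if "lin v W" for v W s
    using that unfolding lin_def by blast+
  txt \<open>Incompressibility keeps the determinant of \<open>(W1, W2)\<close> equal to 1, which turns the conservation of
    \<open>grad \<theta> \<bullet> W\<close> into the transport law for \<open>perp_grad \<theta>\<close>.\<close>
  define m where "m s = W1 s $ 1 * W2 s $ 2 - W2 s $ 1 * W1 s $ 2" for s
  have "m s = m t" if "s \<in> ?I" for s
  proof (rule constant_on_zero_vector_derivative[OF _ _ that tI])
    fix s assume s: "s \<in> ?I"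
    have tr: "vel_grad u (X s, s) $ 1 $ 1 + vel_grad u (X s, s) $ 2 $ 2 = 0"
      using equationsD(3)[OF X_slab[OF s]] by (simp add: divergence_def vel_grad_def sum_2)
    have c: "((\<lambda>s. W s $ i) has_vector_derivative (vel_grad u (X s, s) *v W s) $ i) (at s within ?I)"
      if "lin v W" for v W i
      by (rule bounded_linear.has_vector_derivative[OF bounded_linear_vec_nth W(2)[OF that s]])
    have "(m has_vector_derivative
        (W1 s $ 1 * (vel_grad u (X s, s) *v W2 s) $ 2 + (vel_grad u (X s, s) *v W1 s) $ 1 * W2 s $ 2)
        - (W2 s $ 1 * (vel_grad u (X s, s) *v W1 s) $ 2 + (vel_grad u (X s, s) *v W2 s) $ 1 * W1 s $ 2)) (at s within ?I)"
      unfolding m_def by (intro has_vector_derivative_diff has_vector_derivative_mult c[OF W12(1)] c[OF W12(2)])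
    \<comment> \<open>Liouville's formula: the determinant of two solutions grows at the rate given
      by the trace of the velocity gradient.\<close>
    also have "(W1 s $ 1 * (vel_grad u (X s, s) *v W2 s) $ 2 + (vel_grad u (X s, s) *v W1 s) $ 1 * W2 s $ 2)
        - (W2 s $ 1 * (vel_grad u (X s, s) *v W1 s) $ 2 + (vel_grad u (X s, s) *v W2 s) $ 1 * W1 s $ 2)
        = (vel_grad u (X s, s) $ 1 $ 1 + vel_grad u (X s, s) $ 2 $ 2) * m s"
      by (simp add: matrix_vector_mult_def sum_2 m_def algebra_simps)
    finally show "(m has_vector_derivative 0) (at s within ?I)"
      by (simp add: tr)
  qed auto
  then have m: "m s = 1" if "s \<in> ?I" for s
    using that by (simp add: m_def W(1)[OF W12(1)] W(1)[OF W12(2)] axis_def)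
  \<comment> \<open>Cramer's rule: the conserved products with \<open>W1\<close> and
    \<open>W2\<close> determine \<open>grad \<theta>\<close>, and with determinant 1 its rotation is
    a combination of \<open>W1\<close> and \<open>W2\<close> with coefficients frozen at time
    \<open>t\<close>.\<close>
  have perp: "perp_grad \<theta> (X s, s) = g $ 1 *\<^sub>R W2 s - g $ 2 *\<^sub>R W1 s" if s: "s \<in> ?I" for s
  proof -
    define \<gamma> where "\<gamma> = grad \<theta> (X s, s)"
    have 1: "g $ 1 = \<gamma> $ 1 * W1 s $ 1 + \<gamma> $ 2 * W1 s $ 2" "g $ 2 = \<gamma> $ 1 * W2 s $ 1 + \<gamma> $ 2 * W2 s $ 2"
      using W(3)[OF W12(1) s] W(3)[OF W12(2) s]
      by (simp_all add: inner_axis inner_vec_def[of \<gamma>] sum_2 \<gamma>_def[symmetric])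
    have "g $ 1 * W2 s $ 1 - g $ 2 * W1 s $ 1 = - \<gamma> $ 2 * m s" "g $ 1 * W2 s $ 2 - g $ 2 * W1 s $ 2 = \<gamma> $ 1 * m s"
      unfolding 1 m_def by (simp_all add: algebra_simps)
    then show ?thesis
      using m[OF s] by (simp add: vec_eq_iff forall_2 perp_grad_def \<gamma>_def grad_def)
  qed
  have at_t: "at t within ?I = at t"
    using S(1) by (intro at_within_Icc_at) auto
  have open_I: "open {t - d<..<t + d}" "t \<in> {t - d<..<t + d}"
    using S(1) by auto
  have F: "((\<lambda>s. g $ 1 *\<^sub>R W2 s - g $ 2 *\<^sub>R W1 s) has_vector_derivative
      g $ 1 *\<^sub>R (vel_grad u (X t, t) *v W2 t) - g $ 2 *\<^sub>R (vel_grad u (X t, t) *v W1 t)) (at t)"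
    unfolding at_t[symmetric]
    by (intro has_vector_derivative_diff bounded_linear.has_vector_derivative[OF bounded_linear_scaleR_right] W(2)[OF W12(1) tI] W(2)[OF W12(2) tI])
  have "((\<lambda>s. perp_grad \<theta> (X s, s)) has_vector_derivative
      g $ 1 *\<^sub>R (vel_grad u (X t, t) *v W2 t) - g $ 2 *\<^sub>R (vel_grad u (X t, t) *v W1 t)) (at t)"
    by (rule has_vector_derivative_transform_within_open[OF F open_I]) (simp add: perp)
  then show "((\<lambda>s. perp_grad \<theta> (X s, s)) has_vector_derivative U_perp_grad u \<theta> z) (at (snd z))"
    unfolding zt(2) using perp[OF tI] by (simp add: zt(1) U_perp_grad_def matrix_vector_mult_combination)
  have "((\<lambda>s. g $ 1 *\<^sub>R A (X s, s) (W2 s) - g $ 2 *\<^sub>R A (X s, s) (W1 s)) has_vector_derivative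
      g $ 1 *\<^sub>R (- (hessian p (X t, t) *v W2 t) + (g \<bullet> axis 2 1) *\<^sub>R axis 2 1)
      - g $ 2 *\<^sub>R (- (hessian p (X t, t) *v W1 t) + (g \<bullet> axis 1 1) *\<^sub>R axis 2 1)) (at t)"
    unfolding at_t[symmetric]
    by (intro has_vector_derivative_diff bounded_linear.has_vector_derivative[OF bounded_linear_scaleR_right] W(4)[OF W12(1) tI] W(4)[OF W12(2) tI])
  then have "((\<lambda>s. U_perp_grad u \<theta> (X s, s)) has_vector_derivative
      g $ 1 *\<^sub>R (- (hessian p (X t, t) *v W2 t) + (g \<bullet> axis 2 1) *\<^sub>R axis 2 1)
      - g $ 2 *\<^sub>R (- (hessian p (X t, t) *v W1 t) + (g \<bullet> axis 1 1) *\<^sub>R axis 2 1)) (at t)"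
    by (rule has_vector_derivative_transform_within_open[OF _ open_I])
      (simp add: U_perp_grad_def perp matrix_vector_mult_combination A(2) X_slab)
  \<comment> \<open>The buoyancy terms have coefficients \<open>g $ 1 * g $ 2\<close> and
    \<open>g $ 2 * g $ 1\<close> and cancel, reflecting that \<open>g\<close> is orthogonal to its
    rotation.\<close>
  moreover have "g $ 1 *\<^sub>R (- (hessian p (X t, t) *v W2 t) + (g \<bullet> axis 2 1) *\<^sub>R axis 2 1)
      - g $ 2 *\<^sub>R (- (hessian p (X t, t) *v W1 t) + (g \<bullet> axis 1 1) *\<^sub>R axis 2 1)
      = - (hessian p z *v perp_grad \<theta> z)"
    unfolding zt(1) perp[OF tI] matrix_vector_mult_combination by (simp add: inner_axis algebra_simps)
  ultimately show "((\<lambda>s. U_perp_grad u \<theta> (X s, s)) has_vector_derivative - (hessian p z *v perp_grad \<theta> z)) (at (snd z))"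
    by (simp add: zt(2))
qed

lemma has_material_derivativeI:
  assumes "z \<in> slab T"
    and "\<And>X. trajectory_through u z X \<Longrightarrow> ((\<lambda>s. f (X s, s)) has_vector_derivative D) (at (snd z))"
  shows "has_material_derivative u f D z"
proof -
  obtain X where "trajectory_through u z X"
    using trajectory_exists[OF assms(1)] .
  with assms(2) show ?thesis
    unfolding has_material_derivative_def by blast
qed

end

section \<open>Norm and direction along trajectories\<close>

lemma has_vector_derivative_norm:
  fixes f :: "real \<Rightarrow> 'a::real_inner"
  assumes "(f has_vector_derivative f') (at t)" "f t \<noteq> 0"
  shows "((\<lambda>s. norm (f s)) has_vector_derivative (f t \<bullet> f') / norm (f t)) (at t)"
proof -
  have "((\<lambda>s. norm (f s)) has_derivative (\<lambda>h. (h *\<^sub>R f') \<bullet> sgn (f t))) (at t)"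
    using assms(1) has_derivative_norm[OF assms(2)] unfolding has_vector_derivative_def
    by (rule has_derivative_compose)
  moreover have "(\<lambda>h. (h *\<^sub>R f') \<bullet> sgn (f t)) = (\<lambda>h. h *\<^sub>R ((f t \<bullet> f') / norm (f t)))"
    by (simp add: fun_eq_iff sgn_div_norm inner_commute divide_inverse)
  ultimately show ?thesis
    by (simp add: has_vector_derivative_def)
qed

text \<open>The derivative is the component of \<open>f'\<close> orthogonal to \<open>f t\<close>,
  divided by \<open>norm (f t)\<close>.\<close>

lemma has_vector_derivative_direction:
  fixes f :: "real \<Rightarrow> 'a::real_inner"
  assumes f: "(f has_vector_derivative f') (at t)" "f t \<noteq> 0"
  shows "((\<lambda>s. f s /\<^sub>R norm (f s)) has_vector_derivative
     f' /\<^sub>R norm (f t) - ((f t \<bullet> f') / norm (f t) ^ 3) *\<^sub>R f t) (at t)"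
proof -
  have "((\<lambda>s. norm (f s)) has_real_derivative (f t \<bullet> f') / norm (f t)) (at t)"
    using has_vector_derivative_norm[OF f] by (simp add: has_real_derivative_iff_has_vector_derivative)
  from DERIV_inverse_fun[OF this] f(2)
  have "((\<lambda>s. inverse (norm (f s))) has_real_derivative - ((f t \<bullet> f') / norm (f t) ^ 3)) (at t)"
    by (simp add: field_simps power_numeral_reduce)
  from has_vector_derivative_scaleR[OF this f(1)] show ?thesis
    by (simp add: algebra_simps)
qed

lemma has_vector_derivative_ln_norm:
  fixes f :: "real \<Rightarrow> 'a::real_inner"
  assumes f: "(f has_vector_derivative f') (at t)" "f t \<noteq> 0"
  shows "((\<lambda>s. ln (norm (f s))) has_vector_derivative (f t \<bullet> f') / (norm (f t))\<^sup>2) (at t)"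
proof -
  have "((\<lambda>s. norm (f s)) has_real_derivative (f t \<bullet> f') / norm (f t)) (at t)"
    using has_vector_derivative_norm[OF f] by (simp add: has_real_derivative_iff_has_vector_derivative)
  from DERIV_chain2[OF DERIV_ln_divide this] show ?thesis
    using f(2) by (simp add: has_real_derivative_iff_has_vector_derivative power2_eq_square)
qed

text \<open>When \<open>g\<close> is the derivative of \<open>f\<close> throughout, the quotient is
  the derivative of \<open>ln (norm (f s))\<close>, so this is the second derivative of the
  logarithm.\<close>

lemma has_vector_derivative_logarithmic:
  fixes f g :: "real \<Rightarrow> 'a::real_inner"
  assumes f: "(f has_vector_derivative g t) (at t)" "f t \<noteq> 0" and g: "(g has_vector_derivative g') (at t)"
  shows "((\<lambda>s. (f s \<bullet> g s) / (norm (f s))\<^sup>2) has_vector_derivative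
     ((norm (g t))\<^sup>2 + f t \<bullet> g') / (norm (f t))\<^sup>2 - 2 * ((f t \<bullet> g t) / (norm (f t))\<^sup>2)\<^sup>2) (at t)"
proof -
  have "((\<lambda>s. f s \<bullet> g s) has_real_derivative f t \<bullet> g' + g t \<bullet> g t) (at t)"
    unfolding has_real_derivative_iff_has_vector_derivative
    by (rule bounded_bilinear.has_vector_derivative[OF bounded_bilinear_inner f(1) g])
  moreover have "((\<lambda>s. f s \<bullet> f s) has_real_derivative f t \<bullet> g t + g t \<bullet> f t) (at t)"
    unfolding has_real_derivative_iff_has_vector_derivative
    by (rule bounded_bilinear.has_vector_derivative[OF bounded_bilinear_inner f(1) f(1)])
  ultimately have "((\<lambda>s. (f s \<bullet> g s) / (f s \<bullet> f s)) has_real_derivative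
      ((f t \<bullet> g' + g t \<bullet> g t) * (f t \<bullet> f t) - (f t \<bullet> g t) * (f t \<bullet> g t + g t \<bullet> f t)) / ((f t \<bullet> f t) * (f t \<bullet> f t))) (at t)"
    using f(2) by (intro DERIV_divide) auto
  moreover have "((f t \<bullet> g' + g t \<bullet> g t) * (f t \<bullet> f t) - (f t \<bullet> g t) * (f t \<bullet> g t + g t \<bullet> f t)) / ((f t \<bullet> f t) * (f t \<bullet> f t))
     = (g t \<bullet> g t + f t \<bullet> g') / (f t \<bullet> f t) - 2 * ((f t \<bullet> g t) / (f t \<bullet> f t))\<^sup>2"
    using f(2) by (simp add: inner_commute[of "g t" "f t"] field_simps power2_eq_square)
  ultimately show ?thesis
    by (simp add: has_real_derivative_iff_has_vector_derivative power2_norm_eq_inner)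
qed

text \<open>Pythagoras for \<open>f'\<close>: its radial part is the derivative of the norm, and its
  part orthogonal to \<open>f\<close> is the derivative of the direction times
  \<open>norm f\<close>.\<close>

lemma polar_decomposition_of_derivative:
  fixes f f' :: "'a::real_inner"
  assumes "f \<noteq> 0"
  shows "((f \<bullet> f') / norm f)\<^sup>2 + (norm (f' /\<^sub>R norm f - ((f \<bullet> f') / norm f ^ 3) *\<^sub>R f) * norm f)\<^sup>2 = (norm f')\<^sup>2"
proof -
  define N where "N = norm f"
  have N: "N \<noteq> 0" "f \<bullet> f = N\<^sup>2"
    using assms by (auto simp: N_def power2_norm_eq_inner)
  have "(norm (f' /\<^sub>R N - ((f \<bullet> f') / N ^ 3) *\<^sub>R f))\<^sup>2
      = (f' \<bullet> f') / N\<^sup>2 - 2 * ((f \<bullet> f') / N ^ 3) * (f \<bullet> f') / N + ((f \<bullet> f') / N ^ 3)\<^sup>2 * N\<^sup>2"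
    unfolding power2_norm_eq_inner
    by (simp add: inner_diff_left inner_diff_right N(2) inner_commute[of f' f] divide_inverse power2_eq_square algebra_simps)
  moreover have "(a / N)\<^sup>2 + (b / N\<^sup>2 - 2 * (a / N ^ 3) * a / N + (a / N ^ 3)\<^sup>2 * N\<^sup>2) * N\<^sup>2 = b" for a b :: real
    using N(1) by (simp add: field_simps power_numeral_reduce)
  ultimately show ?thesis
    unfolding N_def[symmetric] power_mult_distrib power2_norm_eq_inner[of f'] by simp
qed

lemma material_differentiableI: "has_material_derivative u f D z \<Longrightarrow> material_differentiable u f z"
  unfolding material_differentiable_def by blast

section \<open>Material derivatives of norms, directions and logarithms\<close>

context boussinesq_solution
begin

lemma material_derivatives_norm_direction_ln:
  fixes F :: "(real ^ 2) \<times> real \<Rightarrow> 'b::real_inner"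
  assumes z: "z \<in> slab T" and nz: "F z \<noteq> 0"
    and F: "\<And>X. trajectory_through u z X \<Longrightarrow> ((\<lambda>s. F (X s, s)) has_vector_derivative F') (at (snd z))"
  shows "has_material_derivative u (\<lambda>w. norm (F w)) ((F z \<bullet> F') / norm (F z)) z"
    and "has_material_derivative u (\<lambda>w. F w /\<^sub>R norm (F w))
      (F' /\<^sub>R norm (F z) - ((F z \<bullet> F') / norm (F z) ^ 3) *\<^sub>R F z) z"
    and "has_material_derivative u (\<lambda>w. ln (norm (F w))) ((F z \<bullet> F') / (norm (F z))\<^sup>2) z"
proof -
  have zX: "(X (snd z), snd z) = z" if "trajectory_through u z X" for X
    using that unfolding trajectory_through_def by simp
  show "has_material_derivative u (\<lambda>w. norm (F w)) ((F z \<bullet> F') / norm (F z)) z"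
  proof (rule has_material_derivativeI[OF z])
    fix X assume X: "trajectory_through u z X"
    from has_vector_derivative_norm[OF F[OF X], unfolded zX[OF X], OF nz]
    show "((\<lambda>s. norm (F (X s, s))) has_vector_derivative (F z \<bullet> F') / norm (F z)) (at (snd z))" .
  qed
  show "has_material_derivative u (\<lambda>w. F w /\<^sub>R norm (F w))
      (F' /\<^sub>R norm (F z) - ((F z \<bullet> F') / norm (F z) ^ 3) *\<^sub>R F z) z"
  proof (rule has_material_derivativeI[OF z])
    fix X assume X: "trajectory_through u z X"
    from has_vector_derivative_direction[OF F[OF X], unfolded zX[OF X], OF nz]
    show "((\<lambda>s. F (X s, s) /\<^sub>R norm (F (X s, s))) has_vector_derivative
        F' /\<^sub>R norm (F z) - ((F z \<bullet> F') / norm (F z) ^ 3) *\<^sub>R F z) (at (snd z))" .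
  qed
  show "has_material_derivative u (\<lambda>w. ln (norm (F w))) ((F z \<bullet> F') / (norm (F z))\<^sup>2) z"
  proof (rule has_material_derivativeI[OF z])
    fix X assume X: "trajectory_through u z X"
    from has_vector_derivative_ln_norm[OF F[OF X], unfolded zX[OF X], OF nz]
    show "((\<lambda>s. ln (norm (F (X s, s)))) has_vector_derivative (F z \<bullet> F') / (norm (F z))\<^sup>2) (at (snd z))" .
  qed
qed

lemma material_derivatives_perp_grad:
  assumes z: "z \<in> slab T" and nz: "perp_grad \<theta> z \<noteq> 0"
  shows "has_material_derivative u (\<lambda>w. norm (perp_grad \<theta> w))
      ((perp_grad \<theta> z \<bullet> U_perp_grad u \<theta> z) / norm (perp_grad \<theta> z)) z"
    and "has_material_derivative u (xi \<theta>)
      (U_perp_grad u \<theta> z /\<^sub>R norm (perp_grad \<theta> z)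
        - ((perp_grad \<theta> z \<bullet> U_perp_grad u \<theta> z) / norm (perp_grad \<theta> z) ^ 3) *\<^sub>R perp_grad \<theta> z) z"
    and "has_material_derivative u (\<lambda>w. ln (norm (perp_grad \<theta> w)))
      ((perp_grad \<theta> z \<bullet> U_perp_grad u \<theta> z) / (norm (perp_grad \<theta> z))\<^sup>2) z"
  unfolding xi_def[abs_def]
  by (rule material_derivatives_norm_direction_ln[OF z nz perp_grad_evolution(1)[OF z]], assumption)+

lemma second_material_derivative_ln:
  assumes z: "z \<in> slab T" and nz: "perp_grad \<theta> z \<noteq> 0"
  shows "has_material_derivative u (Dt u (\<lambda>w. ln (norm (perp_grad \<theta> w))))
      ((norm (vel_grad u z *v xi \<theta> z))\<^sup>2 - 2 * (alpha u \<theta> z)\<^sup>2 - rho p \<theta> z) z"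
proof (rule has_material_derivativeI[OF z])
  fix X assume X: "trajectory_through u z X"
  define t where "t = snd z"
  define f where "f s = perp_grad \<theta> (X s, s)" for s
  define g where "g s = U_perp_grad u \<theta> (X s, s)" for s
  have zt: "(X t, t) = z"
    using X unfolding trajectory_through_def t_def by simp
  have f': "(f has_vector_derivative g t) (at t)" and g': "(g has_vector_derivative - (hessian p z *v f t)) (at t)"
    using perp_grad_evolution[OF z X] unfolding f_def[abs_def] g_def[abs_def] zt t_def[symmetric] .
  have ft: "f t \<noteq> 0"
    using nz by (simp add: f_def zt)
  have "isCont f t"
    using f' by (rule has_vector_derivative_continuous)
  \<comment> \<open>To differentiate the first material derivative once more, its formula must hold
    at all nearby points of the trajectory; continuity keeps \<open>f\<close> nonzero there.\<close>
  then have "\<forall>\<^sub>F s in nhds t. f s \<noteq> 0"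
    using ft by (simp add: continuous_at tendsto_at_iff_tendsto_nhds tendsto_imp_eventually_ne)
  moreover have "0 < t" "t < T"
    using z zt mem_slab[of "X t" t T] by auto
  then have "\<forall>\<^sub>F s in nhds t. s \<in> {0<..<T}"
    by (intro eventually_nhds_in_open) auto
  \<comment> \<open>The curve \<open>X\<close> is also a trajectory through each of its own points
    near \<open>z\<close>.\<close>
  moreover have "\<forall>\<^sub>F s in nhds t. \<forall>\<^sub>F q in nhds s. (X has_vector_derivative u (X q, q)) (at q)"
    using X unfolding eventually_eventually trajectory_through_def t_def by blast
  ultimately have ev: "\<forall>\<^sub>F s in nhds t. (f s \<bullet> g s) / (norm (f s))\<^sup>2 = Dt u (\<lambda>w. ln (norm (perp_grad \<theta> w))) (X s, s)"
  proof eventually_elim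
    case (elim s)
    then show ?case
      using material_derivatives_perp_grad(3)[of "(X s, s)", THEN Dt_eqI]
      by (simp add: mem_slab f_def g_def)
  qed
  \<comment> \<open>Dividing \<open>f t\<close> by its norm gives \<open>xi\<close>, so homogeneity
    turns the three quotients into \<open>norm (vel_grad u z *v xi \<theta> z)\<close> squared,
    \<open>rho\<close> and \<open>alpha\<close>.\<close>
  have eq: "((norm (g t))\<^sup>2 + f t \<bullet> (- (hessian p z *v f t))) / (norm (f t))\<^sup>2 - 2 * ((f t \<bullet> g t) / (norm (f t))\<^sup>2)\<^sup>2
      = (norm (vel_grad u z *v xi \<theta> z))\<^sup>2 - 2 * (alpha u \<theta> z)\<^sup>2 - rho p \<theta> z"
  proof -
    have scale: "M *v xi \<theta> z = (M *v f t) /\<^sub>R norm (f t)" for M :: "real ^ 2 ^ 2"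
      unfolding xi_def f_def zt by (rule linear_cmul[OF matrix_vector_mul_linear])
    have gt: "g t = vel_grad u z *v f t"
      by (simp add: g_def f_def zt U_perp_grad_def)
    have xi: "xi \<theta> z = f t /\<^sub>R norm (f t)"
      by (simp add: xi_def f_def zt)
    have "(norm (vel_grad u z *v xi \<theta> z))\<^sup>2 = (norm (g t))\<^sup>2 / (norm (f t))\<^sup>2"
      by (simp add: scale gt power_mult_distrib power_inverse divide_inverse mult.commute)
    moreover have "alpha u \<theta> z = (f t \<bullet> g t) / (norm (f t))\<^sup>2"
      unfolding alpha_def scale gt unfolding xi by (simp add: divide_inverse power2_eq_square)
    moreover have "rho p \<theta> z = (f t \<bullet> (hessian p z *v f t)) / (norm (f t))\<^sup>2"
      unfolding rho_def scale unfolding xi by (simp add: divide_inverse power2_eq_square)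
    ultimately show ?thesis
      by (simp add: diff_divide_distrib)
  qed
  show "((\<lambda>s. Dt u (\<lambda>w. ln (norm (perp_grad \<theta> w))) (X s, s)) has_vector_derivative
      (norm (vel_grad u z *v xi \<theta> z))\<^sup>2 - 2 * (alpha u \<theta> z)\<^sup>2 - rho p \<theta> z) (at (snd z))"
    using has_vector_derivative_logarithmic[OF f' ft g'] unfolding eq t_def[symmetric]
    by (rule has_vector_derivative_cong_ev[THEN iffD1, rotated 2])
      (use ev eventually_nhds_x_imp_x[OF ev] in \<open>auto elim: eventually_mono\<close>)
qed

lemma material_derivatives_U_perp_grad:
  assumes z: "z \<in> slab T" and nz: "U_perp_grad u \<theta> z \<noteq> 0"
  shows "has_material_derivative u (\<lambda>w. norm (U_perp_grad u \<theta> w))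
      ((U_perp_grad u \<theta> z \<bullet> (- (hessian p z *v perp_grad \<theta> z))) / norm (U_perp_grad u \<theta> z)) z"
    and "has_material_derivative u (zeta u \<theta>)
      ((- (hessian p z *v perp_grad \<theta> z)) /\<^sub>R norm (U_perp_grad u \<theta> z)
        - ((U_perp_grad u \<theta> z \<bullet> (- (hessian p z *v perp_grad \<theta> z))) / norm (U_perp_grad u \<theta> z) ^ 3)
          *\<^sub>R U_perp_grad u \<theta> z) z"
  unfolding zeta_def[abs_def]
  by (rule material_derivatives_norm_direction_ln[OF z nz perp_grad_evolution(2)[OF z]], assumption)+

lemma perp_grad_identities:
  assumes z: "z \<in> slab T" and nz: "perp_grad \<theta> z \<noteq> 0"
  shows "(Dt u (\<lambda>w. norm (perp_grad \<theta> w)) z)\<^sup>2 + (norm (Dt u (xi \<theta>) z) * norm (perp_grad \<theta> z))\<^sup>2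
      = (norm (U_perp_grad u \<theta> z))\<^sup>2"
  unfolding material_derivatives_perp_grad(1,2)[OF assms, THEN Dt_eqI]
  by (rule polar_decomposition_of_derivative[OF nz])

lemma U_perp_grad_identities:
  assumes z: "z \<in> slab T" and nz: "U_perp_grad u \<theta> z \<noteq> 0"
  shows "Dt u (\<lambda>w. norm (U_perp_grad u \<theta> w)) z = - (zeta u \<theta> z \<bullet> (hessian p z *v perp_grad \<theta> z))"
    and "(Dt u (\<lambda>w. norm (U_perp_grad u \<theta> w)) z)\<^sup>2
        + (norm (Dt u (zeta u \<theta>) z) * norm (U_perp_grad u \<theta> z))\<^sup>2 = (norm (hessian p z *v perp_grad \<theta> z))\<^sup>2"
proof -
  note D = material_derivatives_U_perp_grad[OF assms, THEN Dt_eqI]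
  show "Dt u (\<lambda>w. norm (U_perp_grad u \<theta> w)) z = - (zeta u \<theta> z \<bullet> (hessian p z *v perp_grad \<theta> z))"
    unfolding D(1) by (simp add: zeta_def divide_inverse mult.commute)
  show "(Dt u (\<lambda>w. norm (U_perp_grad u \<theta> w)) z)\<^sup>2
        + (norm (Dt u (zeta u \<theta>) z) * norm (U_perp_grad u \<theta> z))\<^sup>2 = (norm (hessian p z *v perp_grad \<theta> z))\<^sup>2"
    unfolding D using polar_decomposition_of_derivative[OF nz] by (metis norm_minus_cancel)
qed

end

section \<open>The five identities for \<open>perp_grad \<theta>\<close> and
  \<open>U_perp_grad u \<theta>\<close>\<close>

theorem proposition2p1:
  fixes u :: "(real ^ 2) \<times> real \<Rightarrow> real ^ 2"
    and p \<theta> :: "(real ^ 2) \<times> real \<Rightarrow> real"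
    and T :: real
  assumes "0 < T"
    and "C1_on u (slab T)" and "C1_on p (slab T)" and "C1_on \<theta> (slab T)"
    and "boussinesq_2d u p \<theta> T"
    and "continuous_hessian_on p (slab T)"
  shows
    "(\<forall>z\<in>slab T. perp_grad \<theta> z \<noteq> 0 \<longrightarrow>
        material_differentiable u (\<lambda>w. norm (perp_grad \<theta> w)) z \<and>
        material_differentiable u (xi \<theta>) z \<and>
        material_differentiable u (\<lambda>w. ln (norm (perp_grad \<theta> w))) z \<and>
        material_differentiable u (Dt u (\<lambda>w. ln (norm (perp_grad \<theta> w)))) z \<and>
        Dt u (Dt u (\<lambda>w. ln (norm (perp_grad \<theta> w)))) z
          = (norm (vel_grad u z *v xi \<theta> z))\<^sup>2 - 2 * (alpha u \<theta> z)\<^sup>2 - rho p \<theta> z \<and>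
        (Dt u (\<lambda>w. norm (perp_grad \<theta> w)) z)\<^sup>2
            + (norm (Dt u (xi \<theta>) z) * norm (perp_grad \<theta> z))\<^sup>2
          = (norm (U_perp_grad u \<theta> z))\<^sup>2)
     \<and>
     (\<forall>z\<in>slab T. U_perp_grad u \<theta> z \<noteq> 0 \<longrightarrow>
        material_differentiable u (\<lambda>w. norm (perp_grad \<theta> w)) z \<and>
        material_differentiable u (xi \<theta>) z \<and>
        material_differentiable u (\<lambda>w. norm (U_perp_grad u \<theta> w)) z \<and>
        material_differentiable u (zeta u \<theta>) z \<and>
        Dt u (\<lambda>w. norm (U_perp_grad u \<theta> w)) z
          = - (zeta u \<theta> z \<bullet> (hessian p z *v perp_grad \<theta> z)) \<and>
        (Dt u (\<lambda>w. norm (U_perp_grad u \<theta> w)) z)\<^sup>2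
            + (norm (Dt u (zeta u \<theta>) z) * norm (U_perp_grad u \<theta> z))\<^sup>2
          = (norm (hessian p z *v perp_grad \<theta> z))\<^sup>2 \<and>
        (Dt u (\<lambda>w. norm (U_perp_grad u \<theta> w)) z)\<^sup>2
            + (norm (Dt u (zeta u \<theta>) z) * Dt u (\<lambda>w. norm (perp_grad \<theta> w)) z)\<^sup>2
            + (norm (Dt u (zeta u \<theta>) z) * norm (Dt u (xi \<theta>) z) * norm (perp_grad \<theta> z))\<^sup>2
          = (norm (hessian p z *v perp_grad \<theta> z))\<^sup>2)"
proof -
  interpret boussinesq_solution u p \<theta> T
    using assms by unfold_locales
  \<comment> \<open>A matrix maps 0 to 0, so wherever \<open>zeta\<close> is a genuine direction,
    \<open>xi\<close> is one too.\<close>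
  have perp_nz: "perp_grad \<theta> z \<noteq> 0" if "U_perp_grad u \<theta> z \<noteq> 0" for z
    using that by (auto simp: U_perp_grad_def)
  have last: "(Dt u (\<lambda>w. norm (U_perp_grad u \<theta> w)) z)\<^sup>2
            + (norm (Dt u (zeta u \<theta>) z) * Dt u (\<lambda>w. norm (perp_grad \<theta> w)) z)\<^sup>2
            + (norm (Dt u (zeta u \<theta>) z) * norm (Dt u (xi \<theta>) z) * norm (perp_grad \<theta> z))\<^sup>2
          = (norm (hessian p z *v perp_grad \<theta> z))\<^sup>2" if z: "z \<in> slab T" and nz: "U_perp_grad u \<theta> z \<noteq> 0" for z
  proof -
    \<comment> \<open>The last identity is the fourth with the squared norm of
      \<open>U_perp_grad u \<theta> z\<close> replaced by means of the third, scaled by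
      \<open>norm (Dt u (zeta u \<theta>) z)\<close>.\<close>
    have *: "(n * a)\<^sup>2 + (n * b * c)\<^sup>2 = (n * d)\<^sup>2" if "a\<^sup>2 + (b * c)\<^sup>2 = d\<^sup>2" for n a b c d :: real
      using that by (metis distrib_left mult.assoc power_mult_distrib)
    show ?thesis
      unfolding add.assoc *[OF perp_grad_identities[OF z perp_nz[OF nz]]]
      by (rule U_perp_grad_identities(2)[OF z nz])
  qed
  show ?thesis
  proof (intro conjI ballI impI)
    fix z assume z: "z \<in> slab T" and nz: "perp_grad \<theta> z \<noteq> 0"
    note D = material_derivatives_perp_grad[OF z nz] second_material_derivative_ln[OF z nz]
    show "material_differentiable u (\<lambda>w. norm (perp_grad \<theta> w)) z" "material_differentiable u (xi \<theta>) z"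
      "material_differentiable u (\<lambda>w. ln (norm (perp_grad \<theta> w))) z"
      "material_differentiable u (Dt u (\<lambda>w. ln (norm (perp_grad \<theta> w)))) z"
      by (rule D[THEN material_differentiableI])+
    show "Dt u (Dt u (\<lambda>w. ln (norm (perp_grad \<theta> w)))) z
          = (norm (vel_grad u z *v xi \<theta> z))\<^sup>2 - 2 * (alpha u \<theta> z)\<^sup>2 - rho p \<theta> z"
      by (rule Dt_eqI[OF D(4)])
    show "(Dt u (\<lambda>w. norm (perp_grad \<theta> w)) z)\<^sup>2 + (norm (Dt u (xi \<theta>) z) * norm (perp_grad \<theta> z))\<^sup>2
          = (norm (U_perp_grad u \<theta> z))\<^sup>2"
      by (rule perp_grad_identities[OF z nz])
  next
    fix z assume z: "z \<in> slab T" and nz: "U_perp_grad u \<theta> z \<noteq> 0"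
    note D = material_derivatives_perp_grad[OF z perp_nz[OF nz]] material_derivatives_U_perp_grad[OF z nz]
    show "material_differentiable u (\<lambda>w. norm (perp_grad \<theta> w)) z" "material_differentiable u (xi \<theta>) z"
      "material_differentiable u (\<lambda>w. norm (U_perp_grad u \<theta> w)) z" "material_differentiable u (zeta u \<theta>) z"
      by (rule D[THEN material_differentiableI])+
    show "Dt u (\<lambda>w. norm (U_perp_grad u \<theta> w)) z = - (zeta u \<theta> z \<bullet> (hessian p z *v perp_grad \<theta> z))"
      "(Dt u (\<lambda>w. norm (U_perp_grad u \<theta> w)) z)\<^sup>2 + (norm (Dt u (zeta u \<theta>) z) * norm (U_perp_grad u \<theta> z))\<^sup>2
          = (norm (hessian p z *v perp_grad \<theta> z))\<^sup>2"
      by (rule U_perp_grad_identities[OF z nz])+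
  qed (rule last)
qed

end
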